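(* Let $\mathbb{F}$ be a finite field with $q=|\mathbb{F}|$ elements, let $r$ be a positive integer, let $\underline{s}=(s_1>\cdots>s_r>s_{r+1}=0)$ be a strictly decreasing sequence of integers and let $V$ be a finite-dimensional $\mathbb{F}$-vector space for which the morphism $\phi_{\underline{s}}(V):\mathbb{F}[\mathfrak{Flag}_r](V)\to\Gamma^{[\underline{s}]_q}(V)$ is a monomorphism. Let $\underline{s^+}$ denote the sequence given by $s_i^+=s_i+1$ for $1\leq i\leq r$, and $s^+_{r+1}=0$. Then the morphism $$\phi_{\underline{s^+}}(V):\ \mathbb{F}[\mathfrak{Flag}_r](V)\to\Gamma^{[\underline{s^+}]_q}(V)$$ is a monomorphism.
   Context: Notation. For a natural number $s$, $[s]_q:=q^s-1$; for a sequence $\underline{s}=(s_1\geq\cdots\geq s_r>s_{r+1}=0)$ of integers, $[\underline{s}]_q:=\sum_{i=1}^r [s_i]_q$. Divided powers. $\Gamma^n(V):=(V^{\otimes n})^{\mathfrak{S}_n}$ is the $n$th divided power functor (symmetric tensors), $\Gamma^0=\mathbb{F}$. $\Gamma^*(V)=\bigoplus_n\Gamma^n(V)$ is a graded commutative associative algebra under the divided power (shuffle) product $\Gamma^a\otimes\Gamma^b\to\Gamma^{a+b}$. For $x\in V$, $x^{\otimes n}\in\Gamma^n(V)$ denotes the corresponding symmetric tensor, so that $x^{\otimes a}x^{\otimes b}=\binom{a+b}{a}x^{\otimes(a+b)}$. Flags. A complete flag of length $r$ in $V$ is a chain of subspaces $W_1<W_2<\cdots<W_r\leq V$ with $\dim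 W_i=i$. $\mathbb{F}[\mathfrak{Flag}_r](V)$ is the $\mathbb{F}$-vector space with basis the set of complete flags of length $r$ in $V$; it is a functor of $V$, a linear map sending a complete flag to its image if this is a complete flag, and to zero otherwise. The morphism $\phi_{\underline{s}}$. For $\underline{s}=(s_1\geq\cdots\geq s_r>s_{r+1}=0)$, $\phi_{\underline{s}}:\mathbb{F}[\mathfrak{Flag}_r]\to\Gamma^{[\underline{s}]_q}$ is the natural transformation sending the complete flag $\langle v_1\rangle<\langle v_1,v_2\rangle<\cdots<\langle v_1,\dots,v_r\rangle$ (with $v_1,\dots,v_r\in V$ linearly independent) to the product $\prod_{i=1}^r v_i^{\otimes[s_i]_q}\in\Gamma^{[\underline{s}]_q}(V)$; this is well defined, independent of the choice of the $v_i$. *)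

theory Defs
  imports
    Complex_Main
    "HOL-Library.Cardinality"
    "HOL-Library.Poly_Mapping"
    "HOL-Combinatorics.Permutations"
    "HOL-Algebra.Module"
begin

section \<open>Free vector spaces\<close>

text \<open>
  The type \<open>'a \<Rightarrow>\<^sub>0 'k\<close> of finitely supported functions is the free \<open>'k\<close>-vector space on the
  type \<open>'a\<close>, with basis the elements \<open>Poly_Mapping.single a 1\<close>.
\<close>

definition fscale :: "'k::field \<Rightarrow> ('a \<Rightarrow>\<^sub>0 'k) \<Rightarrow> ('a \<Rightarrow>\<^sub>0 'k)"
  where "fscale c = Poly_Mapping.map ((*) c)"

definition lin_ext :: "('a \<Rightarrow> ('b \<Rightarrow>\<^sub>0 'k::field)) \<Rightarrow> ('a \<Rightarrow>\<^sub>0 'k) \<Rightarrow> ('b \<Rightarrow>\<^sub>0 'k)"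
  where "lin_ext h f = (\<Sum>a\<in>Poly_Mapping.keys f. fscale (Poly_Mapping.lookup f a) (h a))"

lemma lookup_fscale [simp]:
  "Poly_Mapping.lookup (fscale c f) a = c * Poly_Mapping.lookup f a"
  unfolding fscale_def by transfer (auto simp: when_def)

interpretation free: vector_space fscale
  by unfold_locales (auto intro!: poly_mapping_eqI simp: lookup_add algebra_simps)

lemma fscale_single [simp]: "fscale c (Poly_Mapping.single a b) = Poly_Mapping.single a (c * b)"
  by (rule poly_mapping_eqI) (auto simp: lookup_single when_def)

lemma lin_ext_superset:
  assumes "finite S" "Poly_Mapping.keys f \<subseteq> S"
  shows "lin_ext h f = (\<Sum>a\<in>S. fscale (Poly_Mapping.lookup f a) (h a))"
  unfolding lin_ext_def using assms
  by (intro sum.mono_neutral_left) (auto simp: in_keys_iff)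

lemma lin_ext_add: "lin_ext h (f + g) = lin_ext h f + lin_ext h g"
proof -
  let ?S = "Poly_Mapping.keys f \<union> Poly_Mapping.keys g"
  have "lin_ext h (f + g) = (\<Sum>a\<in>?S. fscale (Poly_Mapping.lookup (f + g) a) (h a))"
    by (rule lin_ext_superset) (auto simp: Poly_Mapping.keys_add)
  also have "\<dots> = (\<Sum>a\<in>?S. fscale (Poly_Mapping.lookup f a) (h a))
                   + (\<Sum>a\<in>?S. fscale (Poly_Mapping.lookup g a) (h a))"
    by (simp add: lookup_add free.scale_left_distrib sum.distrib)
  also have "\<dots> = lin_ext h f + lin_ext h g"
    by (simp add: lin_ext_superset[symmetric])
  finally show ?thesis .
qed

lemma lin_ext_fscale: "lin_ext h (fscale c f) = fscale c (lin_ext h f)"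
proof -
  have "lin_ext h (fscale c f) =
      (\<Sum>a\<in>Poly_Mapping.keys f. fscale (Poly_Mapping.lookup (fscale c f) a) (h a))"
    by (rule lin_ext_superset) (auto simp: in_keys_iff)
  also have "\<dots> = fscale c (lin_ext h f)"
    by (simp add: lin_ext_def free.scale_sum_right)
  finally show ?thesis .
qed

lemma lin_ext_zero [simp]: "lin_ext h 0 = 0"
  by (simp add: lin_ext_def)

lemma lin_ext_diff: "lin_ext h (f - g) = lin_ext h f - lin_ext h g"
  using lin_ext_add[of h "f - g" g] by (simp add: algebra_simps)

lemma lin_ext_sum: "lin_ext h (\<Sum>i\<in>I. f i) = (\<Sum>i\<in>I. lin_ext h (f i))"
  by (induction I rule: infinite_finite_induct) (auto simp: lin_ext_add)

lemma lin_ext_single [simp]: "lin_ext h (Poly_Mapping.single a c) = fscale c (h a)"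
  by (simp add: lin_ext_def)

lemma lin_ext_hom_diff: "lin_ext (\<lambda>a. h a - h' a) f = lin_ext h f - lin_ext h' f"
  by (simp add: lin_ext_def free.scale_right_diff_distrib sum_subtractf)

lemma lin_ext_hom_fscale: "lin_ext (\<lambda>a. fscale c (h a)) f = fscale c (lin_ext h f)"
  by (simp add: lin_ext_def free.scale_sum_right mult.commute)

lemma lin_ext_hom_sum: "lin_ext (\<lambda>a. \<Sum>i\<in>I. h i a) f = (\<Sum>i\<in>I. lin_ext (h i) f)"
  by (simp add: lin_ext_def free.scale_sum_right) (rule sum.swap)

lemma lin_ext_lin_ext: "lin_ext h (lin_ext g f) = lin_ext (\<lambda>a. lin_ext h (g a)) f"
  by (simp add: lin_ext_def[of g] lin_ext_def[of "\<lambda>a. lin_ext h (g a)"] lin_ext_sum lin_ext_fscale)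

lemma lin_ext_swap:
  "lin_ext (\<lambda>a. lin_ext (B a) g) f = lin_ext (\<lambda>b. lin_ext (\<lambda>a. B a b) f) g"
  by (simp add: lin_ext_def free.scale_sum_right mult.commute) (rule sum.swap)

lemma lin_ext_cong:
  "f = f' \<Longrightarrow> (\<And>a. a \<in> Poly_Mapping.keys f \<Longrightarrow> h a = h' a) \<Longrightarrow> lin_ext h f = lin_ext h' f'"
  by (simp add: lin_ext_def)

lemma keys_lin_ext:
  assumes "b \<in> Poly_Mapping.keys (lin_ext h f)"
  obtains a where "a \<in> Poly_Mapping.keys f" "b \<in> Poly_Mapping.keys (h a)"
proof -
  have "\<exists>a\<in>Poly_Mapping.keys f. Poly_Mapping.lookup (fscale (Poly_Mapping.lookup f a) (h a)) b \<noteq> 0"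
  proof (rule ccontr)
    assume "\<not> ?thesis"
    then have "Poly_Mapping.lookup (lin_ext h f) b = 0"
      unfolding lin_ext_def lookup_sum by (intro sum.neutral) blast
    with assms show False by (simp add: in_keys_iff)
  qed
  with that show ?thesis by (auto simp: in_keys_iff)
qed


section \<open>Tensor powers\<close>

text \<open>
  Throughout, a vector space \<open>V\<close> is given by its scalar multiplication \<open>scale\<close>, with underlying
  additive group the type \<open>'v\<close>. The word \<open>[x\<^sub>1, \<dots>, x\<^sub>n]\<close> stands for
  \<open>x\<^sub>1 \<otimes> \<dots> \<otimes> x\<^sub>n\<close>; the tensor space \<open>\<Oplus>\<^sub>n V\<^sup>\<otimes>\<^sup>n\<close> is the quotient of the free vector space on
  all words by the subspace spanned by the multilinearity relations, and its elements are
  represented by cosets. Since the relations are homogeneous, \<open>V\<^sup>\<otimes>\<^sup>n\<close> is the set of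
  cosets of combinations of words of length \<open>n\<close>.
\<close>

definition tensor_rel :: "('k::field \<Rightarrow> 'v::ab_group_add \<Rightarrow> 'v) \<Rightarrow> ('v list \<Rightarrow>\<^sub>0 'k) set" where
  "tensor_rel scale = Modules.module.span fscale
     ({Poly_Mapping.single (w[i := x + y]) 1
         - Poly_Mapping.single (w[i := x]) 1 - Poly_Mapping.single (w[i := y]) 1
       | w i x y. i < length w}
    \<union> {Poly_Mapping.single (w[i := scale c x]) 1 - fscale c (Poly_Mapping.single (w[i := x]) 1)
       | w i c x. i < length w})"

definition tensor_class ::
    "('k::field \<Rightarrow> 'v::ab_group_add \<Rightarrow> 'v) \<Rightarrow> ('v list \<Rightarrow>\<^sub>0 'k) \<Rightarrow> ('v list \<Rightarrow>\<^sub>0 'k) set"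
  where "tensor_class scale f = {g. g - f \<in> tensor_rel scale}"

definition homogeneous :: "nat \<Rightarrow> ('v list \<Rightarrow>\<^sub>0 'k::zero) set"
  where "homogeneous n = {f. \<forall>w\<in>Poly_Mapping.keys f. length w = n}"

definition tensor_power ::
    "('k::field \<Rightarrow> 'v::ab_group_add \<Rightarrow> 'v) \<Rightarrow> nat \<Rightarrow> ('v list \<Rightarrow>\<^sub>0 'k) set set"
  where "tensor_power scale n = tensor_class scale ` homogeneous n"

definition permute_word_comb :: "(nat \<Rightarrow> nat) \<Rightarrow> ('v list \<Rightarrow>\<^sub>0 'k::field) \<Rightarrow> ('v list \<Rightarrow>\<^sub>0 'k)"
  where "permute_word_comb \<sigma> = lin_ext (\<lambda>w. Poly_Mapping.single (permute_list \<sigma> w) 1)"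

text \<open>The invariants \<open>(V\<^sup>\<otimes>\<^sup>n)\<^sup>\<SS>\<close> under the symmetric group on \<open>n\<close> letters.\<close>

definition divided_power ::
    "('k::field \<Rightarrow> 'v::ab_group_add \<Rightarrow> 'v) \<Rightarrow> nat \<Rightarrow> ('v list \<Rightarrow>\<^sub>0 'k) set set"
  where "divided_power scale n =
    {tensor_class scale f | f. f \<in> homogeneous n \<and>
       (\<forall>\<sigma>. \<sigma> permutes {..<n} \<longrightarrow>
          tensor_class scale (permute_word_comb \<sigma> f) = tensor_class scale f)}"


section \<open>The shuffle product\<close>

text \<open>
  \<open>interleave A u v\<close> has the letters of \<open>u\<close>, in order, at the positions in \<open>A\<close> and those of \<open>v\<close>,
  in order, at the remaining positions.
\<close>

definition interleave :: "nat set \<Rightarrow> 'v list \<Rightarrow> 'v list \<Rightarrow> 'v list"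
  where "interleave A u v =
    map (\<lambda>i. if i \<in> A then u ! card (A \<inter> {..<i}) else v ! card ({..<i} - A))
        [0..<length u + length v]"

definition shuffle_word :: "'v list \<Rightarrow> 'v list \<Rightarrow> ('v list \<Rightarrow>\<^sub>0 'k::field)"
  where "shuffle_word u v =
    (\<Sum>A | A \<subseteq> {..<length u + length v} \<and> card A = length u.
        Poly_Mapping.single (interleave A u v) 1)"

definition shuffle :: "('v list \<Rightarrow>\<^sub>0 'k::field) \<Rightarrow> ('v list \<Rightarrow>\<^sub>0 'k) \<Rightarrow> ('v list \<Rightarrow>\<^sub>0 'k)"
  where "shuffle f g = lin_ext (\<lambda>u. lin_ext (\<lambda>v. shuffle_word u v) g) f"

text \<open>
  The tensor space with the shuffle product; the graded algebra of divided powers is the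
  subalgebra spanned by the \<open>divided_power scale n\<close>. The operations are given on cosets: the unions
  are over representatives, on which the resulting cosets do not depend.
\<close>

definition shuffle_algebra ::
    "('k::field \<Rightarrow> 'v::ab_group_add \<Rightarrow> 'v) \<Rightarrow> ('k, ('v list \<Rightarrow>\<^sub>0 'k) set) module"
  where "shuffle_algebra scale =
    \<lparr>carrier = range (tensor_class scale),
     monoid.mult = (\<lambda>X Y. \<Union>f\<in>X. \<Union>g\<in>Y. tensor_class scale (shuffle f g)),
     one = tensor_class scale (Poly_Mapping.single [] 1),
     zero = tensor_class scale 0,
     add = (\<lambda>X Y. \<Union>f\<in>X. \<Union>g\<in>Y. tensor_class scale (f + g)),
     smult = (\<lambda>c X. \<Union>f\<in>X. tensor_class scale (fscale c f))\<rparr>"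

text \<open>The symmetric tensor \<open>x\<^sup>\<otimes>\<^sup>n\<close>.\<close>

definition tensor_pow ::
    "('k::field \<Rightarrow> 'v::ab_group_add \<Rightarrow> 'v) \<Rightarrow> 'v \<Rightarrow> nat \<Rightarrow> ('v list \<Rightarrow>\<^sub>0 'k) set"
  where "tensor_pow scale x n = tensor_class scale (Poly_Mapping.single (replicate n x) 1)"


section \<open>Flags and the morphism to divided powers\<close>

text \<open>A flag \<open>W\<^sub>1 < \<dots> < W\<^sub>r\<close> is the list \<open>[W\<^sub>1, \<dots>, W\<^sub>r]\<close>, so that \<open>W\<^sub>i\<close> is \<open>W ! (i - 1)\<close>.\<close>

definition complete_flags ::
    "('k::field \<Rightarrow> 'v::ab_group_add \<Rightarrow> 'v) \<Rightarrow> nat \<Rightarrow> 'v set list set"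
  where "complete_flags scale r =
    {W. length W = r \<and>
        (\<forall>i<r. Modules.module.subspace scale (W ! i) \<and> vector_space.dim scale (W ! i) = i + 1) \<and>
        (\<forall>i. i + 1 < r \<longrightarrow> W ! i \<subset> W ! (i + 1))}"

definition flag_space ::
    "('k::field \<Rightarrow> 'v::ab_group_add \<Rightarrow> 'v) \<Rightarrow> nat \<Rightarrow> ('v set list \<Rightarrow>\<^sub>0 'k) set"
  where "flag_space scale r = {f. Poly_Mapping.keys f \<subseteq> complete_flags scale r}"

definition adapted_basis ::
    "('k::field \<Rightarrow> 'v::ab_group_add \<Rightarrow> 'v) \<Rightarrow> 'v set list \<Rightarrow> 'v list \<Rightarrow> bool"
  where "adapted_basis scale W vs \<longleftrightarrow>
    length vs = length W \<and> distinct vs \<and> \<not> Modules.module.dependent scale (set vs) \<and>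
    (\<forall>i<length W. W ! i = Modules.module.span scale (set (take (i + 1) vs)))"

definition qnum :: "nat \<Rightarrow> nat \<Rightarrow> nat"
  where "qnum q n = q ^ n - 1"

definition qnum_seq :: "nat \<Rightarrow> nat list \<Rightarrow> nat"
  where "qnum_seq q s = (\<Sum>n\<leftarrow>s. qnum q n)"

text \<open>
  A sequence \<open>s\<^sub>1 \<ge> \<dots> \<ge> s\<^sub>r > s\<^sub>r\<^sub>+\<^sub>1 = 0\<close> is given by the list \<open>[s\<^sub>1, \<dots>, s\<^sub>r]\<close>.
\<close>

definition pow_product ::
    "('k::{field,finite} \<Rightarrow> 'v::ab_group_add \<Rightarrow> 'v) \<Rightarrow> nat list \<Rightarrow> 'v list \<Rightarrow> ('v list \<Rightarrow>\<^sub>0 'k) set"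
  where "pow_product scale s vs =
    foldr (\<lambda>X Y. X \<otimes>\<^bsub>shuffle_algebra scale\<^esub> Y)
      (map2 (\<lambda>x n. tensor_pow scale x (qnum CARD('k) n)) vs s) \<one>\<^bsub>shuffle_algebra scale\<^esub>"

text \<open>
  For weakly decreasing \<open>s\<close> the product depends only on the flag, not on the adapted basis.
\<close>

definition phi_flag ::
    "('k::{field,finite} \<Rightarrow> 'v::ab_group_add \<Rightarrow> 'v) \<Rightarrow> nat list \<Rightarrow> 'v set list \<Rightarrow> ('v list \<Rightarrow>\<^sub>0 'k) set"
  where "phi_flag scale s W = pow_product scale s (SOME vs. adapted_basis scale W vs)"

definition phi ::
    "('k::{field,finite} \<Rightarrow> 'v::ab_group_add \<Rightarrow> 'v) \<Rightarrow> nat list \<Rightarrow> ('v set list \<Rightarrow>\<^sub>0 'k)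
      \<Rightarrow> ('v list \<Rightarrow>\<^sub>0 'k) set"
  where "phi scale s f =
    (\<Oplus>\<^bsub>shuffle_algebra scale\<^esub> W\<in>Poly_Mapping.keys f.
        Poly_Mapping.lookup f W \<odot>\<^bsub>shuffle_algebra scale\<^esub> phi_flag scale s W)"

section \<open>Well-definedness on cosets\<close>

lemma tensor_rel_zero [simp]: "0 \<in> tensor_rel scale"
  unfolding tensor_rel_def by (rule free.span_zero)

lemma tensor_rel_add: "f \<in> tensor_rel scale \<Longrightarrow> g \<in> tensor_rel scale \<Longrightarrow> f + g \<in> tensor_rel scale"
  unfolding tensor_rel_def by (rule free.span_add)

lemma tensor_rel_diff: "f \<in> tensor_rel scale \<Longrightarrow> g \<in> tensor_rel scale \<Longrightarrow> f - g \<in> tensor_rel scale"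
  unfolding tensor_rel_def by (rule free.span_diff)

lemma tensor_rel_fscale: "f \<in> tensor_rel scale \<Longrightarrow> fscale c f \<in> tensor_rel scale"
  unfolding tensor_rel_def by (rule free.span_scale)

lemma tensor_rel_sum: "(\<And>i. i \<in> I \<Longrightarrow> f i \<in> tensor_rel scale) \<Longrightarrow> sum f I \<in> tensor_rel scale"
  unfolding tensor_rel_def by (rule free.span_sum)

lemma tensor_rel_lin_ext:
  "(\<And>a. a \<in> Poly_Mapping.keys f \<Longrightarrow> h a \<in> tensor_rel scale) \<Longrightarrow> lin_ext h f \<in> tensor_rel scale"
  unfolding lin_ext_def by (intro tensor_rel_sum tensor_rel_fscale)

lemma tensor_class_eq_iff: "tensor_class scale f = tensor_class scale g \<longleftrightarrow> f - g \<in> tensor_rel scale"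
proof
  assume "tensor_class scale f = tensor_class scale g"
  moreover have "f \<in> tensor_class scale f" by (simp add: tensor_class_def)
  ultimately show "f - g \<in> tensor_rel scale" by (simp add: tensor_class_def)
next
  assume fg: "f - g \<in> tensor_rel scale"
  show "tensor_class scale f = tensor_class scale g"
    unfolding tensor_class_def
  proof (intro Collect_cong iffI)
    fix h assume "h - f \<in> tensor_rel scale"
    from tensor_rel_add[OF this fg] show "h - g \<in> tensor_rel scale" by simp
  next
    fix h assume "h - g \<in> tensor_rel scale"
    from tensor_rel_diff[OF this fg] show "h - f \<in> tensor_rel scale" by simp
  qed
qed

lemma in_tensor_class_self [simp]: "f \<in> tensor_class scale f"
  by (simp add: tensor_class_def)

lemma in_tensor_class_iff: "g \<in> tensor_class scale f \<longleftrightarrow> tensor_class scale g = tensor_class scale f"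
  by (simp only: tensor_class_eq_iff) (simp add: tensor_class_def)

lemma tensor_class_UN:
  assumes "\<And>f'. tensor_class scale f' = tensor_class scale f \<Longrightarrow> H f' = H f"
  shows "(\<Union>f'\<in>tensor_class scale f. H f') = H f"
proof (intro equalityI subsetI)
  fix x assume "x \<in> (\<Union>f'\<in>tensor_class scale f. H f')"
  then obtain f' where "f' \<in> tensor_class scale f" "x \<in> H f'" by (elim UN_E)
  moreover from this have "H f' = H f" by (intro assms) (rule iffD1[OF in_tensor_class_iff])
  ultimately show "x \<in> H f" by simp
next
  fix x assume "x \<in> H f"
  then show "x \<in> (\<Union>f'\<in>tensor_class scale f. H f')"
    by (intro UN_I[OF in_tensor_class_self])
qed

lemma tensor_class_UN2:
  assumes "\<And>f' g'. \<lbrakk>tensor_class scale f' = tensor_class scale f;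
      tensor_class scale g' = tensor_class scale g\<rbrakk> \<Longrightarrow> H f' g' = H f g"
  shows "(\<Union>f'\<in>tensor_class scale f. \<Union>g'\<in>tensor_class scale g. H f' g') = H f g"
proof -
  have H: "H f' g' = H f g" if "f' \<in> tensor_class scale f" "g' \<in> tensor_class scale g" for f' g'
    using that by (intro assms; intro iffD1[OF in_tensor_class_iff])
  show ?thesis
  proof (intro equalityI subsetI)
    fix x assume "x \<in> (\<Union>f'\<in>tensor_class scale f. \<Union>g'\<in>tensor_class scale g. H f' g')"
    then obtain f' g' where "f' \<in> tensor_class scale f" "g' \<in> tensor_class scale g" "x \<in> H f' g'"
      by (elim UN_E)
    then show "x \<in> H f g" by (simp only: H)
  next
    fix x assume "x \<in> H f g"
    then show "x \<in> (\<Union>f'\<in>tensor_class scale f. \<Union>g'\<in>tensor_class scale g. H f' g')"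
      by (intro UN_I[OF in_tensor_class_self])
  qed
qed

definition mod_multilinear ::
    "('k::field \<Rightarrow> 'v::ab_group_add \<Rightarrow> 'v) \<Rightarrow> ('v list \<Rightarrow> ('v list \<Rightarrow>\<^sub>0 'k)) \<Rightarrow> bool"
  where "mod_multilinear scale h \<longleftrightarrow>
    (\<forall>w i x y. i < length w \<longrightarrow> h (w[i := x + y]) - h (w[i := x]) - h (w[i := y]) \<in> tensor_rel scale) \<and>
    (\<forall>w i c x. i < length w \<longrightarrow> h (w[i := scale c x]) - fscale c (h (w[i := x])) \<in> tensor_rel scale)"

lemma lin_ext_tensor_rel:
  assumes h: "mod_multilinear scale h" and f: "f \<in> tensor_rel scale"
  shows "lin_ext h f \<in> tensor_rel scale"
proof -
  note f[unfolded tensor_rel_def]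
  then show ?thesis
  proof (induction rule: free.span_induct_alt)
    case base
    show ?case by simp
  next
    case (step c x y)
    have "lin_ext h x \<in> tensor_rel scale"
      using step(1) h unfolding mod_multilinear_def
      by (auto simp: lin_ext_diff lin_ext_fscale simp del: fscale_single)
    then show ?case using step(2)
      by (simp add: lin_ext_add lin_ext_fscale tensor_rel_add tensor_rel_fscale)
  qed
qed

lemma mod_multilinear_lin_ext:
  assumes "\<And>v. mod_multilinear scale (\<lambda>u. B u v)"
  shows "mod_multilinear scale (\<lambda>u. lin_ext (B u) g)"
  using assms unfolding mod_multilinear_def
  by (auto simp flip: lin_ext_hom_diff lin_ext_hom_fscale intro!: tensor_rel_lin_ext)

lemma mod_multilinear_sum:
  assumes "\<And>i. mod_multilinear scale (h i)"
  shows "mod_multilinear scale (\<lambda>u. \<Sum>i\<in>I (length u). h i u)"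
  using assms unfolding mod_multilinear_def
  by (auto simp: free.scale_sum_right simp flip: sum_subtractf intro!: tensor_rel_sum)

text \<open>Counting elements of \<open>A\<close> below \<open>i\<close> gives the index of the letter used at position \<open>i\<close>.\<close>

lemma bij_betw_rank:
  assumes A: "finite (A :: nat set)"
  shows "bij_betw (\<lambda>i. card (A \<inter> {..<i})) A {..<card A}"
proof -
  have mono: "card (A \<inter> {..<i}) < card (A \<inter> {..<j})" if "i \<in> A" "i < j" for i j
    using that by (intro psubset_card_mono) auto
  have "inj_on (\<lambda>i. card (A \<inter> {..<i})) A"
    by (rule linorder_inj_onI') (use mono in \<open>metis less_irrefl\<close>)
  moreover have "(\<lambda>i. card (A \<inter> {..<i})) ` A \<subseteq> {..<card A}"
    using A by (auto intro!: psubset_card_mono)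
  ultimately show ?thesis
    by (metis bij_betw_def card_image card_lessThan card_subset_eq finite_lessThan)
qed

lemma rank_compl:
  "i < n \<Longrightarrow> {..<i} - A = ({..<n} - A) \<inter> {..<i}" for i n :: nat
  by auto

lemma length_interleave [simp]: "length (interleave A u v) = length u + length v"
  by (simp add: interleave_def)

lemma interleave_update_left:
  assumes A: "A \<subseteq> {..<length u + length v}" "card A = length u" and j: "j < length u"
  obtains p where "p < length u + length v"
    "\<And>x. interleave A (u[j := x]) v = (interleave A u v)[p := x]"
proof -
  have "finite A" using A(1) finite_subset by blast
  then have b: "bij_betw (\<lambda>i. card (A \<inter> {..<i})) A {..<length u}"
    using bij_betw_rank A(2) by metis
  then obtain p where p: "p \<in> A" "card (A \<inter> {..<p}) = j"
    using j unfolding bij_betw_def by (metis (no_types, lifting) imageE lessThan_iff)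
  have "interleave A (u[j := x]) v = (interleave A u v)[p := x]" for x
  proof (rule nth_equalityI)
    fix i assume "i < length (interleave A (u[j := x]) v)"
    then have i: "i < length u + length v" by simp
    have "card (A \<inter> {..<i}) = j \<Longrightarrow> i \<in> A \<Longrightarrow> i = p"
      using b p unfolding bij_betw_def inj_on_def by blast
    then show "interleave A (u[j := x]) v ! i = (interleave A u v)[p := x] ! i"
      using i p j subsetD[OF A(1) p(1)] by (auto simp: interleave_def nth_list_update)
  qed simp
  with p A that show ?thesis by blast
qed

lemma interleave_update_right:
  assumes A: "A \<subseteq> {..<length u + length v}" "card A = length u" and j: "j < length v"
  obtains p where "p < length u + length v"
    "\<And>x. interleave A u (v[j := x]) = (interleave A u v)[p := x]"
proof -
  let ?n = "length u + length v"
  let ?B = "{..<?n} - A"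
  have "card ?B = length v" using A by (subst card_Diff_subset) (auto intro: finite_subset)
  then have b: "bij_betw (\<lambda>i. card (?B \<inter> {..<i})) ?B {..<length v}"
    using bij_betw_rank[of ?B] by simp
  then obtain p where p: "p \<in> ?B" "card (?B \<inter> {..<p}) = j"
    using j unfolding bij_betw_def by (metis (no_types, lifting) imageE lessThan_iff)
  have "interleave A u (v[j := x]) = (interleave A u v)[p := x]" for x
  proof (rule nth_equalityI)
    fix i assume "i < length (interleave A u (v[j := x]))"
    then have i: "i < ?n" by simp
    have "card (?B \<inter> {..<i}) = j \<Longrightarrow> i \<in> ?B \<Longrightarrow> i = p"
      using b p unfolding bij_betw_def inj_on_def by blast
    then show "interleave A u (v[j := x]) ! i = (interleave A u v)[p := x] ! i"
      using i p j by (auto simp: interleave_def nth_list_update rank_compl[OF i])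
  qed simp
  with p that show ?thesis by auto
qed

definition place :: "nat set \<Rightarrow> 'v list \<Rightarrow> 'v list \<Rightarrow> ('v list \<Rightarrow>\<^sub>0 'k::field)"
  where "place A u v =
    (if A \<subseteq> {..<length u + length v} \<and> card A = length u
     then Poly_Mapping.single (interleave A u v) 1 else 0)"

lemma tensor_rel_single_add:
  "i < length w \<Longrightarrow> Poly_Mapping.single (w[i := x + y]) 1
     - Poly_Mapping.single (w[i := x]) 1 - Poly_Mapping.single (w[i := y]) 1 \<in> tensor_rel scale"
  unfolding tensor_rel_def by (rule free.span_base) blast

lemma tensor_rel_single_scale:
  "i < length w \<Longrightarrow> Poly_Mapping.single (w[i := scale c x]) 1
     - fscale c (Poly_Mapping.single (w[i := x]) 1) \<in> tensor_rel scale"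
  unfolding tensor_rel_def by (rule free.span_base) blast

lemma mod_multilinear_place_left: "mod_multilinear scale (\<lambda>u. place A u v)"
  unfolding mod_multilinear_def
proof (intro conjI allI impI)
  fix u i x y assume i: "i < length (u :: 'b list)"
  show "place A (u[i := x + y]) v - place A (u[i := x]) v - place A (u[i := y]) v \<in> tensor_rel scale"
  proof (cases "A \<subseteq> {..<length u + length v} \<and> card A = length u")
    case True
    then obtain p where "p < length u + length v"
      "\<And>x. interleave A (u[i := x]) v = (interleave A u v)[p := x]"
      using interleave_update_left i by blast
    then show ?thesis using True by (simp add: place_def tensor_rel_single_add)
  qed (auto simp: place_def)
next
  fix u i c x assume i: "i < length (u :: 'b list)"
  show "place A (u[i := scale c x]) v - fscale c (place A (u[i := x]) v) \<in> tensor_rel scale"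
  proof (cases "A \<subseteq> {..<length u + length v} \<and> card A = length u")
    case True
    then obtain p where "p < length u + length v"
      "\<And>x. interleave A (u[i := x]) v = (interleave A u v)[p := x]"
      using interleave_update_left i by blast
    then show ?thesis using True
      by (simp add: place_def tensor_rel_single_scale del: fscale_single)
  qed (auto simp: place_def)
qed

lemma mod_multilinear_place_right: "mod_multilinear scale (\<lambda>v. place A u v)"
  unfolding mod_multilinear_def
proof (intro conjI allI impI)
  fix v i x y assume i: "i < length (v :: 'b list)"
  show "place A u (v[i := x + y]) - place A u (v[i := x]) - place A u (v[i := y]) \<in> tensor_rel scale"
  proof (cases "A \<subseteq> {..<length u + length v} \<and> card A = length u")
    case True
    then obtain p where "p < length u + length v"
      "\<And>x. interleave A u (v[i := x]) = (interleave A u v)[p := x]"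
      using interleave_update_right i by blast
    then show ?thesis using True by (simp add: place_def tensor_rel_single_add)
  qed (auto simp: place_def)
next
  fix v i c x assume i: "i < length (v :: 'b list)"
  show "place A u (v[i := scale c x]) - fscale c (place A u (v[i := x])) \<in> tensor_rel scale"
  proof (cases "A \<subseteq> {..<length u + length v} \<and> card A = length u")
    case True
    then obtain p where "p < length u + length v"
      "\<And>x. interleave A u (v[i := x]) = (interleave A u v)[p := x]"
      using interleave_update_right i by blast
    then show ?thesis using True
      by (simp add: place_def tensor_rel_single_scale del: fscale_single)
  qed (auto simp: place_def)
qed

definition place_comb :: "nat set \<Rightarrow> ('v list \<Rightarrow>\<^sub>0 'k::field) \<Rightarrow> ('v list \<Rightarrow>\<^sub>0 'k) \<Rightarrow> ('v list \<Rightarrow>\<^sub>0 'k)"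
  where "place_comb A f g = lin_ext (\<lambda>u. lin_ext (\<lambda>v. place A u v) g) f"

lemma place_comb_rel_left: "f \<in> tensor_rel scale \<Longrightarrow> place_comb A f g \<in> tensor_rel scale"
  unfolding place_comb_def
  by (intro lin_ext_tensor_rel mod_multilinear_lin_ext mod_multilinear_place_left)

lemma place_comb_rel_right: "g \<in> tensor_rel scale \<Longrightarrow> place_comb A f g \<in> tensor_rel scale"
  unfolding place_comb_def lin_ext_swap[of _ g f]
  by (intro lin_ext_tensor_rel mod_multilinear_lin_ext mod_multilinear_place_right)

lemma place_comb_diff_left: "place_comb A (f - f') g = place_comb A f g - place_comb A f' g"
  by (simp add: place_comb_def lin_ext_diff)

lemma place_comb_diff_right: "place_comb A f (g - g') = place_comb A f g - place_comb A f g'"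
  by (simp add: place_comb_def lin_ext_diff lin_ext_hom_diff)

lemma place_comb_cong_rel:
  assumes "f - f' \<in> tensor_rel scale" "g - g' \<in> tensor_rel scale"
  shows "place_comb A f g - place_comb A f' g' \<in> tensor_rel scale"
proof -
  have "place_comb A f g - place_comb A f' g' = place_comb A (f - f') g + place_comb A f' (g - g')"
    by (simp add: place_comb_diff_left place_comb_diff_right)
  then show ?thesis
    using assms by (simp add: tensor_rel_add place_comb_rel_left place_comb_rel_right)
qed

lemma shuffle_word_eq_place:
  "(shuffle_word u v :: 'v list \<Rightarrow>\<^sub>0 'k::field) = (\<Sum>A\<in>Pow {..<length u + length v}. place A u v)"
proof -
  have "(\<Sum>A\<in>Pow {..<length u + length v}. place A u v :: 'v list \<Rightarrow>\<^sub>0 'k) =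
     (\<Sum>A\<in>{A. A \<subseteq> {..<length u + length v} \<and> card A = length u}. place A u v)"
    by (rule sum.mono_neutral_right) (auto simp: place_def)
  also have "\<dots> = shuffle_word u v"
    unfolding shuffle_word_def by (rule sum.cong) (auto simp: place_def)
  finally show ?thesis by simp
qed

lemma mod_multilinear_shuffle_left: "mod_multilinear scale (\<lambda>u. shuffle_word u v)"
  unfolding shuffle_word_eq_place
  by (rule mod_multilinear_sum[where I = "\<lambda>n. Pow {..<n + length v}"])
     (rule mod_multilinear_place_left)

lemma mod_multilinear_shuffle_right: "mod_multilinear scale (\<lambda>v. shuffle_word u v)"
  unfolding shuffle_word_eq_place
  by (rule mod_multilinear_sum[where I = "\<lambda>n. Pow {..<length u + n}"])
     (rule mod_multilinear_place_right)

lemma shuffle_rel_left: "f \<in> tensor_rel scale \<Longrightarrow> shuffle f g \<in> tensor_rel scale"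
  unfolding shuffle_def
  by (intro lin_ext_tensor_rel mod_multilinear_lin_ext mod_multilinear_shuffle_left)

lemma shuffle_rel_right: "g \<in> tensor_rel scale \<Longrightarrow> shuffle f g \<in> tensor_rel scale"
  unfolding shuffle_def lin_ext_swap[of _ g f]
  by (intro lin_ext_tensor_rel mod_multilinear_lin_ext mod_multilinear_shuffle_right)

lemma shuffle_diff_left: "shuffle (f - f') g = shuffle f g - shuffle f' g"
  by (simp add: shuffle_def lin_ext_diff)

lemma shuffle_diff_right: "shuffle f (g - g') = shuffle f g - shuffle f g'"
  by (simp add: shuffle_def lin_ext_diff lin_ext_hom_diff)

lemma carrier_shuffle_algebra [simp]:
  "carrier (shuffle_algebra scale) = range (tensor_class scale)"
  by (simp add: shuffle_algebra_def)

lemma one_shuffle_algebra: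
  "\<one>\<^bsub>shuffle_algebra scale\<^esub> = tensor_class scale (Poly_Mapping.single [] 1)"
  by (simp add: shuffle_algebra_def)

lemma zero_shuffle_algebra: "\<zero>\<^bsub>shuffle_algebra scale\<^esub> = tensor_class scale 0"
  by (simp add: shuffle_algebra_def)

lemma mult_shuffle_algebra:
  "tensor_class scale f \<otimes>\<^bsub>shuffle_algebra scale\<^esub> tensor_class scale g = tensor_class scale (shuffle f g)"
proof -
  have *: "tensor_class scale (shuffle f' g') = tensor_class scale (shuffle f g)"
    if "tensor_class scale f' = tensor_class scale f" "tensor_class scale g' = tensor_class scale g"
    for f' g'
  proof -
    have "shuffle f' g' - shuffle f g = shuffle (f' - f) g' + shuffle f (g' - g)"
      by (simp add: shuffle_diff_left shuffle_diff_right)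
    then show ?thesis using that
      by (simp add: tensor_class_eq_iff tensor_rel_add shuffle_rel_left shuffle_rel_right)
  qed
  show ?thesis
    by (simp add: shuffle_algebra_def, rule tensor_class_UN2) (rule *)
qed

lemma add_shuffle_algebra:
  "tensor_class scale f \<oplus>\<^bsub>shuffle_algebra scale\<^esub> tensor_class scale g = tensor_class scale (f + g)"
proof -
  have *: "tensor_class scale (f' + g') = tensor_class scale (f + g)"
    if "tensor_class scale f' = tensor_class scale f" "tensor_class scale g' = tensor_class scale g"
    for f' g'
  proof -
    have "(f' + g') - (f + g) = (f' - f) + (g' - g)" by simp
    then show ?thesis using that by (simp only: tensor_class_eq_iff tensor_rel_add)
  qed
  show ?thesis
    by (simp add: shuffle_algebra_def, rule tensor_class_UN2) (rule *)
qed

lemma smult_shuffle_algebra: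
  "c \<odot>\<^bsub>shuffle_algebra scale\<^esub> tensor_class scale f = tensor_class scale (fscale c f)"
proof -
  have *: "tensor_class scale (fscale c f') = tensor_class scale (fscale c f)"
    if "tensor_class scale f' = tensor_class scale f" for f'
    using that tensor_rel_fscale[of "f' - f" scale c]
    by (simp only: tensor_class_eq_iff free.scale_right_diff_distrib)
  show ?thesis
    by (simp add: shuffle_algebra_def, rule tensor_class_UN) (rule *)
qed

lemma abelian_group_shuffle_algebra: "abelian_group (shuffle_algebra scale)"
proof (rule abelian_groupI)
  fix X assume "X \<in> carrier (shuffle_algebra scale)"
  then obtain f where "X = tensor_class scale f" by auto
  then have "tensor_class scale (- f) \<oplus>\<^bsub>shuffle_algebra scale\<^esub> X = \<zero>\<^bsub>shuffle_algebra scale\<^esub>"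
    by (simp add: add_shuffle_algebra zero_shuffle_algebra)
  then show "\<exists>Y\<in>carrier (shuffle_algebra scale). Y \<oplus>\<^bsub>shuffle_algebra scale\<^esub> X = \<zero>\<^bsub>shuffle_algebra scale\<^esub>"
    by auto
qed (auto simp: add_shuffle_algebra zero_shuffle_algebra add_ac)

lemma finsum_shuffle_algebra:
  assumes "finite I"
  shows "(\<Oplus>\<^bsub>shuffle_algebra scale\<^esub> i\<in>I. tensor_class scale (f i)) = tensor_class scale (\<Sum>i\<in>I. f i)"
proof -
  interpret abelian_group "shuffle_algebra scale" by (rule abelian_group_shuffle_algebra)
  from assms show ?thesis
    by (induction I) (auto simp: zero_shuffle_algebra add_shuffle_algebra)
qed


section \<open>Divided powers form a graded subalgebra\<close>

lemma homogeneous_lin_ext: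
  "(\<And>a. a \<in> Poly_Mapping.keys f \<Longrightarrow> h a \<in> homogeneous n) \<Longrightarrow> lin_ext h f \<in> homogeneous n"
  by (force simp: homogeneous_def elim: keys_lin_ext)

lemma homogeneous_add: "f \<in> homogeneous n \<Longrightarrow> g \<in> homogeneous n \<Longrightarrow> f + g \<in> homogeneous n"
  using Poly_Mapping.keys_add[of f g] by (auto simp: homogeneous_def)

lemma homogeneous_fscale: "f \<in> homogeneous n \<Longrightarrow> fscale c f \<in> homogeneous n"
  by (auto simp: homogeneous_def in_keys_iff)

lemma homogeneous_sum: "(\<And>i. i \<in> I \<Longrightarrow> f i \<in> homogeneous n) \<Longrightarrow> sum f I \<in> homogeneous n"
  by (induction I rule: infinite_finite_induct) (simp_all add: homogeneous_add, simp_all add: homogeneous_def)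

lemma homogeneous_single: "length w = n \<Longrightarrow> Poly_Mapping.single w c \<in> homogeneous n"
  by (auto simp: homogeneous_def split: if_splits)

lemma homogeneous_shuffle:
  assumes "f \<in> homogeneous a" "g \<in> homogeneous b"
  shows "shuffle f g \<in> homogeneous (a + b)"
  unfolding shuffle_def
proof (intro homogeneous_lin_ext)
  fix u v assume "u \<in> Poly_Mapping.keys f" "v \<in> Poly_Mapping.keys g"
  then have "length u = a" "length v = b" using assms by (auto simp: homogeneous_def)
  then show "shuffle_word u v \<in> homogeneous (a + b)"
    unfolding shuffle_word_def by (intro homogeneous_sum homogeneous_single) simp
qed

lemma shuffle_eq_place_comb:
  assumes "f \<in> homogeneous a" "g \<in> homogeneous b"
  shows "shuffle f g = (\<Sum>A | A \<subseteq> {..<a + b} \<and> card A = a. place_comb A f g)"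
proof -
  have "shuffle f g =
      lin_ext (\<lambda>u. lin_ext (\<lambda>v. \<Sum>A | A \<subseteq> {..<a + b} \<and> card A = a. place A u v) g) f"
    unfolding shuffle_def
  proof (intro lin_ext_cong refl)
    fix u v assume "u \<in> Poly_Mapping.keys f" "v \<in> Poly_Mapping.keys g"
    then have "length u = a" "length v = b" using assms by (auto simp: homogeneous_def)
    then show "shuffle_word u v = (\<Sum>A | A \<subseteq> {..<a + b} \<and> card A = a. place A u v)"
      unfolding shuffle_word_def by (intro sum.cong) (auto simp: place_def)
  qed
  then show ?thesis by (simp add: lin_ext_hom_sum place_comb_def)
qed

lemma rank_permutation:
  assumes A: "finite (A :: nat set)" and \<sigma>: "bij_betw \<sigma> (A' :: nat set) A"
  obtains \<alpha> where "\<alpha> permutes {..<card A}"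
    "\<And>i. i \<in> A' \<Longrightarrow> card (A \<inter> {..<\<sigma> i}) = \<alpha> (card (A' \<inter> {..<i}))"
proof -
  have A': "finite A'" "card A' = card A"
    using A bij_betw_finite[OF \<sigma>] bij_betw_same_card[OF \<sigma>] by simp_all
  let ?r = "\<lambda>i. card (A \<inter> {..<i})" and ?r' = "\<lambda>i. card (A' \<inter> {..<i})"
  let ?e = "the_inv_into A' ?r'"
  define \<alpha> where "\<alpha> = (\<lambda>j. if j \<in> {..<card A} then ?r (\<sigma> (?e j)) else j)"
  have b': "bij_betw ?r' A' {..<card A}" using bij_betw_rank[OF A'(1)] A'(2) by simp
  have "bij_betw ((?r \<circ> \<sigma>) \<circ> ?e) {..<card A} {..<card A}"
    by (rule bij_betw_trans[OF bij_betw_the_inv_into[OF b'] bij_betw_trans[OF \<sigma> bij_betw_rank[OF A]]])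
  then have "bij_betw \<alpha> {..<card A} {..<card A}"
    by (rule bij_betw_cong[THEN iffD1, rotated]) (simp add: \<alpha>_def)
  then have "\<alpha> permutes {..<card A}"
    by (rule bij_imp_permutes) (auto simp: \<alpha>_def)
  moreover have "card (A \<inter> {..<\<sigma> i}) = \<alpha> (card (A' \<inter> {..<i}))" if i: "i \<in> A'" for i
  proof -
    have "?r' i < card A" using b' i unfolding bij_betw_def by blast
    moreover have "?e (?r' i) = i"
      by (rule the_inv_into_f_f[OF bij_betw_imp_inj_on[OF b'] i])
    ultimately show ?thesis by (simp add: \<alpha>_def)
  qed
  ultimately show ?thesis by (rule that)
qed

lemma permute_place_comb:
  fixes f g :: "'v::ab_group_add list \<Rightarrow>\<^sub>0 'k::field"
  assumes f: "f \<in> homogeneous a" and g: "g \<in> homogeneous b"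
    and A: "A \<subseteq> {..<a + b}" "card A = a" and \<sigma>: "\<sigma> permutes {..<a + b}"
  obtains \<alpha> \<beta> where "\<alpha> permutes {..<a}" "\<beta> permutes {..<b}"
    "permute_word_comb \<sigma> (place_comb A f g)
       = place_comb (\<sigma> -` A) (permute_word_comb \<alpha> f) (permute_word_comb \<beta> g)"
proof -
  define n where "n = a + b"
  define A' where "A' = \<sigma> -` A"
  have inj: "inj \<sigma>" using \<sigma> permutes_inj by blast
  have surj: "surj \<sigma>" using \<sigma> permutes_surj by blast
  have lt: "\<sigma> i < n \<longleftrightarrow> i < n" for i
    using permutes_in_image[OF \<sigma>, of i] by (simp add: n_def)
  have A'sub: "A' \<subseteq> {..<n}" using A(1) lt by (auto simp: A'_def n_def)
  have bA: "bij_betw \<sigma> A' A"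
    unfolding bij_betw_def A'_def using inj surj by (auto simp: inj_on_def surj_image_vimage_eq)
  have bB: "bij_betw \<sigma> ({..<n} - A') ({..<n} - A)"
    unfolding bij_betw_def
  proof
    show "inj_on \<sigma> ({..<n} - A')" using inj by (auto simp: inj_on_def)
    have "\<sigma> ` {..<n} = {..<n}" using permutes_image[OF \<sigma>] by (simp add: n_def)
    then show "\<sigma> ` ({..<n} - A') = {..<n} - A"
      using bA inj by (simp add: image_set_diff bij_betw_def)
  qed
  have finA: "finite A" using A(1) finite_subset by blast
  have cA': "card A' = a" using bij_betw_same_card[OF bA] A(2) by simp
  have cB: "card ({..<n} - A) = b" using A finA by (simp add: card_Diff_subset n_def)
  obtain \<alpha> where \<alpha>: "\<alpha> permutes {..<a}"
    "\<And>i. i \<in> A' \<Longrightarrow> card (A \<inter> {..<\<sigma> i}) = \<alpha> (card (A' \<inter> {..<i}))"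
    using rank_permutation[OF finA bA] unfolding A(2) by blast
  obtain \<beta> where \<beta>: "\<beta> permutes {..<b}"
    "\<And>i. i \<in> {..<n} - A' \<Longrightarrow>
        card (({..<n} - A) \<inter> {..<\<sigma> i}) = \<beta> (card (({..<n} - A') \<inter> {..<i}))"
    using rank_permutation[OF _ bB] unfolding cB by blast
  have bij_r: "bij_betw (\<lambda>i. card (A' \<inter> {..<i})) A' {..<a}"
    using bij_betw_rank[of A'] cA' finite_subset[OF A'sub] by simp
  have cB': "card ({..<n} - A') = b" using bij_betw_same_card[OF bB] cB by simp
  have bij_s: "bij_betw (\<lambda>i. card (({..<n} - A') \<inter> {..<i})) ({..<n} - A') {..<b}"
    using bij_betw_rank[of "{..<n} - A'"] cB' by simp
  have word: "permute_list \<sigma> (interleave A u v) = interleave A' (permute_list \<alpha> u) (permute_list \<beta> v)"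
    if len: "length u = a" "length v = b" for u v :: "'v list"
  proof (rule nth_equalityI)
    fix i assume "i < length (permute_list \<sigma> (interleave A u v))"
    then have i: "i < n" by (simp add: len n_def)
    have L: "permute_list \<sigma> (interleave A u v) ! i = interleave A u v ! \<sigma> i"
      using i by (simp add: permute_list_def len n_def)
    show "permute_list \<sigma> (interleave A u v) ! i
        = interleave A' (permute_list \<alpha> u) (permute_list \<beta> v) ! i"
    proof (cases "i \<in> A'")
      case True
      then have "card (A' \<inter> {..<i}) < a" using bij_r unfolding bij_betw_def by blast
      with True show ?thesis unfolding L using i lt[of i] \<alpha>(2)
        by (simp add: interleave_def len permute_list_def n_def[symmetric]) (simp add: A'_def)
    next
      case False
      then have "card (({..<n} - A') \<inter> {..<i}) < b" using bij_s i unfolding bij_betw_def by blast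
      with False show ?thesis unfolding L using i lt[of i] \<beta>(2)[of i]
        by (simp add: interleave_def len permute_list_def n_def[symmetric] rank_compl[of _ n])
           (simp add: A'_def)
    qed
  qed (simp add: len)
  have "permute_word_comb \<sigma> (place_comb A f g)
      = place_comb A' (permute_word_comb \<alpha> f) (permute_word_comb \<beta> g)"
    unfolding permute_word_comb_def place_comb_def lin_ext_lin_ext lin_ext_single
  proof (simp only: free.scale_one, intro lin_ext_cong refl)
    fix u v assume "u \<in> Poly_Mapping.keys f" "v \<in> Poly_Mapping.keys g"
    then have "length u = a" "length v = b" using f g by (auto simp: homogeneous_def)
    then show "lin_ext (\<lambda>w. Poly_Mapping.single (permute_list \<sigma> w) 1) (place A u v)
        = place A' (permute_list \<alpha> u) (permute_list \<beta> v)"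
      using A A'sub cA' by (simp add: place_def word n_def)
  qed
  with \<alpha>(1) \<beta>(1) that show ?thesis unfolding A'_def by blast
qed

lemma divided_power_mult:
  fixes X Y :: "('v::ab_group_add list \<Rightarrow>\<^sub>0 'k::field) set"
  assumes "X \<in> divided_power scale a" "Y \<in> divided_power scale b"
  shows "X \<otimes>\<^bsub>shuffle_algebra scale\<^esub> Y \<in> divided_power scale (a + b)"
proof -
  obtain f where f: "X = tensor_class scale f" "f \<in> homogeneous a"
    "\<And>\<sigma>. \<sigma> permutes {..<a} \<Longrightarrow> permute_word_comb \<sigma> f - f \<in> tensor_rel scale"
    using assms(1) unfolding divided_power_def tensor_class_eq_iff by blast
  obtain g where g: "Y = tensor_class scale g" "g \<in> homogeneous b"
    "\<And>\<sigma>. \<sigma> permutes {..<b} \<Longrightarrow> permute_word_comb \<sigma> g - g \<in> tensor_rel scale"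
    using assms(2) unfolding divided_power_def tensor_class_eq_iff by blast
  let ?S = "{A. A \<subseteq> {..<a + b} \<and> card A = a}"
  have "permute_word_comb \<sigma> (shuffle f g) - shuffle f g \<in> tensor_rel scale"
    if \<sigma>: "\<sigma> permutes {..<a + b}" for \<sigma>
  proof -
    have inj: "inj \<sigma>" and surj: "surj \<sigma>" using \<sigma> permutes_inj permutes_surj by blast+
    have im: "\<sigma> ` {..<a + b} = {..<a + b}" using permutes_image[OF \<sigma>] .
    have "bij_betw ((-`) \<sigma>) ?S ?S"
    proof (rule bij_betw_byWitness[where f' = "(`) \<sigma>"])
      show "\<forall>A\<in>?S. \<sigma> ` (\<sigma> -` A) = A" using surj by (auto simp: surj_image_vimage_eq)
      show "\<forall>A\<in>?S. \<sigma> -` (\<sigma> ` A) = A" using inj by (auto simp: inj_vimage_image_eq)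
      show "(-`) \<sigma> ` ?S \<subseteq> ?S"
      proof (rule image_subsetI)
        fix A assume "A \<in> ?S"
        then have A: "A \<subseteq> {..<a + b}" "card A = a" by auto
        have "\<sigma> -` A \<subseteq> \<sigma> -` (\<sigma> ` {..<a + b})" using A im by auto
        then have "\<sigma> -` A \<subseteq> {..<a + b}" using inj by (simp add: inj_vimage_image_eq)
        moreover have "card (\<sigma> -` A) = card A"
          using surj inj by (intro card_vimage_inj) auto
        ultimately show "\<sigma> -` A \<in> ?S" using A by simp
      qed
      show "(`) \<sigma> ` ?S \<subseteq> ?S"
        using im inj by (auto simp: card_image inj_on_subset[OF inj])
    qed
    then have "shuffle f g = (\<Sum>A\<in>?S. place_comb (\<sigma> -` A) f g)"
      unfolding shuffle_eq_place_comb[OF f(2) g(2)] by (rule sum.reindex_bij_betw[symmetric])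
    moreover have "permute_word_comb \<sigma> (shuffle f g) = (\<Sum>A\<in>?S. permute_word_comb \<sigma> (place_comb A f g))"
      unfolding shuffle_eq_place_comb[OF f(2) g(2)] by (simp add: permute_word_comb_def lin_ext_sum)
    moreover have "permute_word_comb \<sigma> (place_comb A f g) - place_comb (\<sigma> -` A) f g \<in> tensor_rel scale"
      if "A \<in> ?S" for A
      using that f g \<sigma> permute_place_comb[OF f(2) g(2), of A \<sigma>]
      by (metis (mono_tags, lifting) mem_Collect_eq place_comb_cong_rel)
    ultimately show ?thesis by (auto simp flip: sum_subtractf intro!: tensor_rel_sum)
  qed
  moreover have "X \<otimes>\<^bsub>shuffle_algebra scale\<^esub> Y = tensor_class scale (shuffle f g)"
    by (simp add: f(1) g(1) mult_shuffle_algebra)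
  ultimately show ?thesis
    unfolding divided_power_def tensor_class_eq_iff using homogeneous_shuffle[OF f(2) g(2)] by blast
qed

lemma permute_list_update:
  assumes \<sigma>: "\<sigma> permutes {..<length w}" and j: "j < length w"
  obtains p where "p < length w" "\<And>x. permute_list \<sigma> (w[j := x]) = (permute_list \<sigma> w)[p := x]"
proof -
  obtain p where "\<sigma> p = j" using permutes_surj[OF \<sigma>] by (metis surjD)
  then have eq: "\<sigma> i = j \<longleftrightarrow> i = p" for i using permutes_inj[OF \<sigma>] by (auto dest: injD)
  have p: "p < length w" using permutes_in_image[OF \<sigma>, of p] \<open>\<sigma> p = j\<close> j by simp
  have "permute_list \<sigma> (w[j := x]) = (permute_list \<sigma> w)[p := x]" for x
  proof (rule nth_equalityI)
    fix i assume "i < length (permute_list \<sigma> (w[j := x]))"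
    then have "i < length w" by simp
    then show "permute_list \<sigma> (w[j := x]) ! i = (permute_list \<sigma> w)[p := x] ! i"
      using p j eq[of i] by (cases "i = p") (simp_all add: permute_list_def)
  qed simp
  with p that show ?thesis by blast
qed

text \<open>The action of the symmetric group descends to \<open>V\<^sup>\<otimes>\<^sup>n\<close>.\<close>

lemma permute_word_comb_cong_rel:
  fixes f g :: "'v::ab_group_add list \<Rightarrow>\<^sub>0 'k::field"
  assumes \<sigma>: "\<sigma> permutes {..<n}" and f: "f \<in> homogeneous n" and g: "g \<in> homogeneous n"
    and eq: "tensor_class scale f = tensor_class scale g"
  shows "tensor_class scale (permute_word_comb \<sigma> f) = tensor_class scale (permute_word_comb \<sigma> g)"
proof -
  define h :: "'v list \<Rightarrow> ('v list \<Rightarrow>\<^sub>0 'k)"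
    where "h w = (if length w = n then Poly_Mapping.single (permute_list \<sigma> w) 1 else 0)" for w
  have "mod_multilinear scale h"
    unfolding mod_multilinear_def
  proof (intro conjI allI impI)
    fix w i x y assume i: "i < length (w :: 'v list)"
    show "h (w[i := x + y]) - h (w[i := x]) - h (w[i := y]) \<in> tensor_rel scale"
    proof (cases "length w = n")
      case True
      then obtain p where "p < length w"
        "\<And>x. permute_list \<sigma> (w[i := x]) = (permute_list \<sigma> w)[p := x]"
        using permute_list_update \<sigma> i by blast
      then show ?thesis using True by (simp add: h_def tensor_rel_single_add)
    qed (simp add: h_def)
  next
    fix w i c x assume i: "i < length (w :: 'v list)"
    show "h (w[i := scale c x]) - fscale c (h (w[i := x])) \<in> tensor_rel scale"
    proof (cases "length w = n")
      case True
      then obtain p where "p < length w"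
        "\<And>x. permute_list \<sigma> (w[i := x]) = (permute_list \<sigma> w)[p := x]"
        using permute_list_update \<sigma> i by blast
      then show ?thesis using True
        by (simp add: h_def tensor_rel_single_scale del: fscale_single)
    qed (simp add: h_def)
  qed
  moreover have "permute_word_comb \<sigma> f' = lin_ext h f'" if "f' \<in> homogeneous n" for f'
    unfolding permute_word_comb_def using that
    by (intro lin_ext_cong) (auto simp: homogeneous_def h_def)
  ultimately show ?thesis
    using eq f g lin_ext_tensor_rel[of scale h "f - g"]
    by (simp add: tensor_class_eq_iff lin_ext_diff)
qed

lemma divided_power_subset_tensor_power: "divided_power scale n \<subseteq> tensor_power scale n"
  by (auto simp: divided_power_def tensor_power_def)

lemma divided_power_zero: "\<zero>\<^bsub>shuffle_algebra scale\<^esub> \<in> divided_power scale n"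
  unfolding divided_power_def zero_shuffle_algebra
  by (intro CollectI exI[of _ 0]) (auto simp: homogeneous_def permute_word_comb_def)

lemma divided_power_add:
  assumes "X \<in> divided_power scale n" "Y \<in> divided_power scale n"
  shows "X \<oplus>\<^bsub>shuffle_algebra scale\<^esub> Y \<in> divided_power scale n"
proof -
  obtain f g where "X = tensor_class scale f" "f \<in> homogeneous n"
    "\<forall>\<sigma>. \<sigma> permutes {..<n} \<longrightarrow>
       tensor_class scale (permute_word_comb \<sigma> f) = tensor_class scale f"
    "Y = tensor_class scale g" "g \<in> homogeneous n"
    "\<forall>\<sigma>. \<sigma> permutes {..<n} \<longrightarrow>
       tensor_class scale (permute_word_comb \<sigma> g) = tensor_class scale g"
    using assms unfolding divided_power_def by blast
  then show ?thesis unfolding divided_power_def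
    by (auto simp: add_shuffle_algebra permute_word_comb_def lin_ext_add homogeneous_add
             simp flip: add_shuffle_algebra intro!: exI[of _ "f + g"])
qed

lemma divided_power_smult:
  assumes "X \<in> divided_power scale n"
  shows "c \<odot>\<^bsub>shuffle_algebra scale\<^esub> X \<in> divided_power scale n"
proof -
  obtain f where "X = tensor_class scale f" "f \<in> homogeneous n"
    "\<forall>\<sigma>. \<sigma> permutes {..<n} \<longrightarrow>
       tensor_class scale (permute_word_comb \<sigma> f) = tensor_class scale f"
    using assms unfolding divided_power_def by blast
  then show ?thesis unfolding divided_power_def
    by (auto simp: permute_word_comb_def lin_ext_fscale homogeneous_fscale
             simp flip: smult_shuffle_algebra intro!: exI[of _ "fscale c f"])
qed

lemma tensor_pow_in_divided_power: "tensor_pow scale x n \<in> divided_power scale n"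
proof -
  have "permute_list \<sigma> (replicate n x) = replicate n x" if "\<sigma> permutes {..<n}" for \<sigma>
    using that permutes_in_image[OF that]
    by (intro nth_equalityI) (auto simp: permute_list_def)
  then show ?thesis unfolding divided_power_def tensor_pow_def
    by (intro CollectI exI[of _ "Poly_Mapping.single (replicate n x) 1"])
       (auto simp: permute_word_comb_def homogeneous_single)
qed

lemma divided_power_one: "\<one>\<^bsub>shuffle_algebra scale\<^esub> \<in> divided_power scale 0"
  using tensor_pow_in_divided_power[of scale _ 0]
  by (simp add: tensor_pow_def one_shuffle_algebra)

lemma divided_power_subset_carrier: "divided_power scale n \<subseteq> carrier (shuffle_algebra scale)"
  by (auto simp: divided_power_def)

lemma pow_product_in_divided_power:
  fixes scale :: "'k::{field,finite} \<Rightarrow> 'v::ab_group_add \<Rightarrow> 'v"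
  assumes "length vs = length s"
  shows "pow_product scale s vs \<in> divided_power scale (qnum_seq CARD('k) s)"
  using assms
proof (induction vs s rule: list_induct2)
  case Nil
  then show ?case by (simp add: pow_product_def qnum_seq_def divided_power_one)
next
  case (Cons x vs n s)
  then show ?case
    using divided_power_mult[OF tensor_pow_in_divided_power, of "pow_product scale s vs"]
    by (simp add: pow_product_def qnum_seq_def)
qed


section \<open>The morphism is a linear map into divided powers\<close>

lemma adapted_basis_exists:
  assumes "vector_space scale" and W: "W \<in> complete_flags scale r"
  shows "\<exists>vs. adapted_basis scale W vs"
proof -
  interpret vector_space scale by fact
  have len: "length W = r" and sub: "\<And>i. i < r \<Longrightarrow> subspace (W ! i)"
    and dim: "\<And>i. i < r \<Longrightarrow> dim (W ! i) = i + 1"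
    and less: "\<And>i. i + 1 < r \<Longrightarrow> W ! i \<subset> W ! (i + 1)"
    using W by (auto simp: complete_flags_def)
  have "\<exists>vs. length vs = k \<and> distinct vs \<and> independent (set vs) \<and>
      (\<forall>i<k. W ! i = span (set (take (i + 1) vs)))" if "k \<le> r" for k
    using that
  proof (induction k)
    case 0
    show ?case by (intro exI[of _ "[]"]) (simp add: independent_empty)
  next
    case (Suc k)
    then obtain vs where vs: "length vs = k" "distinct vs" "independent (set vs)"
      "\<And>i. i < k \<Longrightarrow> W ! i = span (set (take (i + 1) vs))" by auto
    have sub_k: "set vs \<subseteq> W ! k"
    proof (cases k)
      case (Suc j)
      then have "set vs \<subseteq> W ! j" using vs by (simp add: span_superset)
      then show ?thesis using less[of j] Suc \<open>Suc k \<le> r\<close> by auto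
    qed (use vs in simp)
    have dk: "dim (W ! k) = k + 1" using dim Suc.prems by simp
    obtain B where B': "set vs \<subseteq> B" "B \<subseteq> W ! k" "independent B" "W ! k \<subseteq> span B"
      by (rule maximal_independent_subset_extend[OF sub_k vs(3)])
    note B = B'(2,3,4,1)
    have "card B = k + 1" using dim_unique[OF B(1,3,2) refl] dk by simp
    then have "card (B - set vs) = 1"
      using B(4) vs(1,2) by (simp add: card_Diff_subset distinct_card)
    then obtain x where x: "B - set vs = {x}" by (auto simp: card_1_singleton_iff)
    then have Bx: "B = set (vs @ [x])" "x \<notin> set vs" using B(4) by auto
    have span_B: "span B = W ! k"
      using B sub Suc.prems by (simp add: span_minimal subset_antisym)
    show ?case
    proof (intro exI[of _ "vs @ [x]"] conjI allI impI)
      fix i assume "i < Suc k"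
      then show "W ! i = span (set (take (i + 1) (vs @ [x])))"
        using vs span_B Bx by (cases "i = k") auto
    qed (use vs Bx B(2) in auto)
  qed
  from this[of r] len show ?thesis unfolding adapted_basis_def by auto
qed

lemma phi_flag_in_divided_power:
  fixes scale :: "'k::{field,finite} \<Rightarrow> 'v::ab_group_add \<Rightarrow> 'v"
  assumes "vector_space scale" "W \<in> complete_flags scale (length s)"
  shows "phi_flag scale s W \<in> divided_power scale (qnum_seq CARD('k) s)"
proof -
  have "adapted_basis scale W (SOME vs. adapted_basis scale W vs)"
    using adapted_basis_exists[OF assms] by (rule someI_ex)
  then have "length (SOME vs. adapted_basis scale W vs) = length W"
    unfolding adapted_basis_def by (rule conjunct1)
  also have "length W = length s" using assms(2) by (simp add: complete_flags_def)
  finally show ?thesis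
    unfolding phi_flag_def by (rule pow_product_in_divided_power)
qed

lemma phi_in_divided_power:
  fixes scale :: "'k::{field,finite} \<Rightarrow> 'v::ab_group_add \<Rightarrow> 'v"
  assumes "vector_space scale" "f \<in> flag_space scale (length s)"
  shows "phi scale s f \<in> divided_power scale (qnum_seq CARD('k) s)"
proof -
  interpret abelian_group "shuffle_algebra scale" by (rule abelian_group_shuffle_algebra)
  let ?t = "\<lambda>W. Poly_Mapping.lookup f W \<odot>\<^bsub>shuffle_algebra scale\<^esub> phi_flag scale s W"
  have "(\<Oplus>\<^bsub>shuffle_algebra scale\<^esub> W\<in>I. ?t W) \<in> divided_power scale (qnum_seq CARD('k) s)"
    if "finite I" "I \<subseteq> complete_flags scale (length s)" for I
    using that
  proof (induction I)
    case empty
    then show ?case by (simp add: divided_power_zero)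
  next
    case (insert W I)
    have t: "?t W' \<in> divided_power scale (qnum_seq CARD('k) s)" if "W' \<in> insert W I" for W'
      using that insert.prems phi_flag_in_divided_power[OF assms(1)] divided_power_smult by blast
    then have "?t \<in> insert W I \<rightarrow> carrier (shuffle_algebra scale)"
      using divided_power_subset_carrier by blast
    then show ?case using insert t by (auto intro!: divided_power_add simp: Pi_iff)
  qed
  then show ?thesis using assms(2) by (simp add: phi_def flag_space_def)
qed

lemma phi_linear:
  fixes scale :: "'k::{field,finite} \<Rightarrow> 'v::ab_group_add \<Rightarrow> 'v"
  assumes "vector_space scale"
    and f: "f \<in> flag_space scale (length s)" and g: "g \<in> flag_space scale (length s)"
  shows "phi scale s (f + g) = phi scale s f \<oplus>\<^bsub>shuffle_algebra scale\<^esub> phi scale s g"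
    and "phi scale s (fscale c f) = c \<odot>\<^bsub>shuffle_algebra scale\<^esub> phi scale s f"
proof -
  define rep where "rep W = (SOME h. phi_flag scale s W = tensor_class scale h)" for W
  have rep: "phi_flag scale s W = tensor_class scale (rep W)"
    if "W \<in> complete_flags scale (length s)" for W
  proof -
    have "\<exists>h. phi_flag scale s W = tensor_class scale h"
      using phi_flag_in_divided_power[OF assms(1) that] by (auto simp: divided_power_def)
    then show ?thesis unfolding rep_def by (rule someI_ex)
  qed
  have phi: "phi scale s h = tensor_class scale (lin_ext rep h)"
    if "h \<in> flag_space scale (length s)" for h
  proof -
    interpret abelian_group "shuffle_algebra scale" by (rule abelian_group_shuffle_algebra)
    have "phi scale s h = (\<Oplus>\<^bsub>shuffle_algebra scale\<^esub> W\<in>Poly_Mapping.keys h.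
        tensor_class scale (fscale (Poly_Mapping.lookup h W) (rep W)))"
      unfolding phi_def using that
      by (intro finsum_cong') (auto simp: flag_space_def rep smult_shuffle_algebra)
    then show ?thesis by (simp add: finsum_shuffle_algebra lin_ext_def)
  qed
  have fg: "f + g \<in> flag_space scale (length s)"
    using f g Poly_Mapping.keys_add[of f g] by (auto simp: flag_space_def)
  show "phi scale s (f + g) = phi scale s f \<oplus>\<^bsub>shuffle_algebra scale\<^esub> phi scale s g"
    by (simp add: phi f g fg lin_ext_add add_shuffle_algebra)
  have cf: "fscale c f \<in> flag_space scale (length s)"
    using f by (auto simp: flag_space_def in_keys_iff subset_iff)
  show "phi scale s (fscale c f) = c \<odot>\<^bsub>shuffle_algebra scale\<^esub> phi scale s f"
    by (simp add: phi f cf lin_ext_fscale smult_shuffle_algebra)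
qed

end

theory Submission
  imports Defs "HOL-Computational_Algebra.Polynomial"
begin

text \<open>
  Fix a basis of \<open>V\<close>. The coefficient of a shuffle product of powers \<open>v\<^sub>i\<^sup>\<otimes>\<^sup>n\<close> with \<open>n = a\<^sub>i\<close> at a
  word \<open>w\<close> in the basis is the coefficient of the monomial with exponents \<open>a\<^sub>i\<close> in \<open>\<Prod>\<^sub>b L\<^sub>b\<close>, where
  \<open>b\<close> runs through the letters of \<open>w\<close> and \<open>L\<^sub>b\<close> is the linear form whose coefficients are the
  \<open>b\<close>-coordinates of \<open>v\<^sub>1, \<dots>, v\<^sub>r\<close>. Since \<open>[n + 1]\<^sub>q = q [n]\<^sub>q + (q - 1)\<close> and
  \<open>L\<^sub>b(t)\<^sup>q = L\<^sub>b(t\<^sup>q)\<close>, the coefficient of the image of a flag for \<open>s\<^sup>+\<close> at \<open>q\<close> copies of \<open>w\<close>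
  followed by a word \<open>w'\<close> of length \<open>r (q - 1)\<close> is the coefficient for \<open>s\<close> at \<open>w\<close> times the
  coefficient for \<open>(1, \<dots>, 1)\<close> at \<open>w'\<close>. A linear relation between the images for \<open>s\<^sup>+\<close> thus yields
  one for \<open>s\<close>, in which each flag has gained the second factor. For a basis extending one adapted
  to a given flag, and \<open>w'\<close> made of \<open>q - 1\<close> copies of each \<open>v\<^sub>i\<close>, this factor is \<open>1\<close> at that flag,
  so the flag does not occur in the relation.
\<close>

section \<open>Frobenius on polynomials over a finite field\<close>

text \<open>Multiplication by a nonzero \<open>x\<close> permutes the nonzero elements, so comparing
  their products gives x^(q - 1) = 1.\<close>

lemma field_power_card:
  fixes x :: "'k::{field,finite}"
  shows "x ^ CARD('k) = x"
proof (cases "x = 0")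
  case False
  let ?U = "UNIV - {0 :: 'k}"
  have "(\<Prod>y\<in>?U. x * y) = \<Prod>?U"
    by (rule prod.reindex_bij_witness[of _ "\<lambda>y. y / x" "\<lambda>y. x * y"]) (use False in auto)
  then have "x ^ card ?U * \<Prod>?U = \<Prod>?U" by (simp add: prod.distrib)
  then have "x ^ card ?U = 1" by simp
  moreover have "CARD('k) = Suc (card ?U)"
    by (rule card_Suc_Diff1[symmetric]) simp_all
  ultimately show ?thesis by (simp only: power_Suc mult_1_right)
qed (simp add: zero_power_eq)

text \<open>The polynomial \<open>(X + 1)\<^sup>q - X\<^sup>q - 1\<close> has degree less than \<open>q\<close> and \<open>q\<close> roots.\<close>

lemma of_nat_card_choose_eq_0:
  assumes "0 < k" "k < CARD('k::{field,finite})"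
  shows "of_nat (CARD('k) choose k) = (0::'k)"
proof -
  let ?q = "CARD('k)"
  define p :: "'k poly" where "p = (\<Sum>k\<in>{1..<?q}. monom (of_nat (?q choose k)) k)"
  have "poly p x = 0" for x
  proof -
    have "(x + 1) ^ ?q = (\<Sum>k\<le>?q. of_nat (?q choose k) * x ^ k)"
      by (simp add: binomial_ring)
    also have "{..?q} = insert 0 (insert ?q {1..<?q})" by auto
    finally have "x + 1 = 1 + (x + poly p x)"
      by (simp add: p_def poly_sum poly_monom field_power_card)
    then show ?thesis by simp
  qed
  then have roots: "{x. poly p x = 0} = UNIV" by simp
  have "degree p \<le> ?q - 1"
    unfolding p_def by (rule degree_sum_le) (auto intro: order.trans[OF degree_monom_le])
  then have "degree p < ?q" using assms by linarith
  then have "p = 0"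
    using card_poly_roots_bound[of p] unfolding roots by auto
  then have "coeff p k = 0" by simp
  then show ?thesis
    using assms by (simp add: p_def coeff_sum)
qed

text \<open>Polynomials in variables \<open>'x\<close> are finitely supported functions on exponent
  vectors; this is the effect on exponent vectors of substituting t^n for every variable t.\<close>

definition scale_exponent :: "nat \<Rightarrow> ('x \<Rightarrow>\<^sub>0 nat) \<Rightarrow> ('x \<Rightarrow>\<^sub>0 nat)"
  where "scale_exponent n = Poly_Mapping.map ((*) n)"

lemma lookup_scale_exponent [simp]:
  "Poly_Mapping.lookup (scale_exponent n m) x = n * Poly_Mapping.lookup m x"
  unfolding scale_exponent_def by transfer (auto simp: when_def)

lemma scale_exponent_add: "scale_exponent n (m + m') = scale_exponent n m + scale_exponent n m'"
  by (rule poly_mapping_eqI) (simp add: lookup_add algebra_simps)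

lemma scale_exponent_single [simp]:
  "scale_exponent n (Poly_Mapping.single x k) = Poly_Mapping.single x (n * k)"
  by (rule poly_mapping_eqI) (simp add: lookup_single when_def)

lemma power_single:
  "Poly_Mapping.single m c ^ n = Poly_Mapping.single (scale_exponent n m) (c ^ n)"
  for m :: "'x \<Rightarrow>\<^sub>0 nat" and c :: "'k::comm_semiring_1"
proof (induction n)
  case 0
  have "scale_exponent 0 m = 0" by (rule poly_mapping_eqI) simp
  then show ?case by simp
next
  case (Suc n)
  have "m + scale_exponent n m = scale_exponent (Suc n) m"
    by (rule poly_mapping_eqI) (simp add: lookup_add)
  then show ?case using Suc by (simp add: mult_single)
qed

lemma sum_single_lookup:
  "f = (\<Sum>a\<in>Poly_Mapping.keys f. Poly_Mapping.single a (Poly_Mapping.lookup f a))"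
  by (rule poly_mapping_eqI) (simp add: lookup_sum lookup_single when_def in_keys_iff)

lemma freshmans_dream_card:
  fixes f g :: "('x \<Rightarrow>\<^sub>0 nat) \<Rightarrow>\<^sub>0 'k::{field,finite}"
  shows "(f + g) ^ CARD('k) = f ^ CARD('k) + g ^ CARD('k)"
proof -
  let ?q = "CARD('k)"
  \<comment> \<open>Integers are constant polynomials, so vanishing in \<open>'k\<close>
    suffices.\<close>
  have "(of_nat (?q choose k) :: ('x \<Rightarrow>\<^sub>0 nat) \<Rightarrow>\<^sub>0 'k) = 0" if "k \<in> {..?q} - {0, ?q}" for k
    using of_nat_card_choose_eq_0[where 'k = 'k, of k] that by (simp flip: single_of_nat)
  then have "(\<Sum>k\<le>?q. of_nat (?q choose k) * f ^ k * g ^ (?q - k))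
      = (\<Sum>k\<in>{0, ?q}. of_nat (?q choose k) * f ^ k * g ^ (?q - k))"
    by (intro sum.mono_neutral_right) auto
  also have "\<dots> = f ^ ?q + g ^ ?q" by (simp add: add.commute)
  finally show ?thesis by (simp only: binomial_ring)
qed

text \<open>This is f(t)^q = f(t^q): taking q-th powers is additive, and c^q = c for every
  coefficient c.\<close>

lemma power_card_eq_scale_exponent:
  fixes f :: "('x \<Rightarrow>\<^sub>0 nat) \<Rightarrow>\<^sub>0 'k::{field,finite}"
  shows "f ^ CARD('k) = (\<Sum>m\<in>Poly_Mapping.keys f.
    Poly_Mapping.single (scale_exponent CARD('k) m) (Poly_Mapping.lookup f m))"
proof -
  have "(\<Sum>m\<in>I. h m) ^ CARD('k) = (\<Sum>m\<in>I. h m ^ CARD('k))" if "finite I"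
    for I and h :: "('x \<Rightarrow>\<^sub>0 nat) \<Rightarrow> ('x \<Rightarrow>\<^sub>0 nat) \<Rightarrow>\<^sub>0 'k"
    using that by (induction I) (simp_all add: freshmans_dream_card zero_power)
  then have "(\<Sum>m\<in>Poly_Mapping.keys f. Poly_Mapping.single m (Poly_Mapping.lookup f m)) ^ CARD('k)
      = (\<Sum>m\<in>Poly_Mapping.keys f.
          Poly_Mapping.single (scale_exponent CARD('k) m) (Poly_Mapping.lookup f m))"
    by (simp add: power_single field_power_card)
  then show ?thesis unfolding sum_single_lookup[symmetric] .
qed

lemma lookup_single_mult_add:
  fixes f :: "('x \<Rightarrow>\<^sub>0 nat) \<Rightarrow>\<^sub>0 'k::comm_semiring_1"
  shows "Poly_Mapping.lookup (Poly_Mapping.single a c * f) (a + k) = c * Poly_Mapping.lookup f k"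
proof -
  have "Poly_Mapping.single a c * f
      = (\<Sum>m\<in>Poly_Mapping.keys f. Poly_Mapping.single (a + m) (c * Poly_Mapping.lookup f m))"
    unfolding mult_single[symmetric] sum_distrib_left[symmetric] sum_single_lookup[symmetric] ..
  then show ?thesis
    by (simp add: lookup_sum lookup_single when_def in_keys_iff)
qed

lemma lookup_single_mult_eq_0:
  fixes f :: "('x \<Rightarrow>\<^sub>0 nat) \<Rightarrow>\<^sub>0 'k::comm_semiring_1"
  assumes "\<And>k. k \<in> Poly_Mapping.keys f \<Longrightarrow> e \<noteq> a + k"
  shows "Poly_Mapping.lookup (Poly_Mapping.single a c * f) e = 0"
proof (rule ccontr)
  assume "\<not> ?thesis"
  then have "e \<in> Poly_Mapping.keys (Poly_Mapping.single a c * f)" by (simp add: in_keys_iff)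
  then obtain a' k where "a' \<in> Poly_Mapping.keys (Poly_Mapping.single a c)"
    "k \<in> Poly_Mapping.keys f" "e = a' + k"
    using keys_mult by blast
  with assms show False by (auto split: if_splits)
qed

section \<open>Products of linear forms\<close>

text \<open>The vectors in \<open>S\<close> themselves serve as variables; \<open>c x b\<close> is
  meant as the \<open>b\<close>-coordinate of \<open>x\<close>.\<close>

definition linear_form :: "('x \<Rightarrow> 'b \<Rightarrow> 'k) \<Rightarrow> 'x set \<Rightarrow> 'b \<Rightarrow> (('x \<Rightarrow>\<^sub>0 nat) \<Rightarrow>\<^sub>0 'k::comm_ring_1)"
  where "linear_form c S b = (\<Sum>x\<in>S. Poly_Mapping.single (Poly_Mapping.single x 1) (c x b))"

lemma keys_linear_form:
  "m \<in> Poly_Mapping.keys (linear_form c S b) \<Longrightarrow> \<exists>x\<in>S. m = Poly_Mapping.single x 1"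
  unfolding linear_form_def
  by (rule ccontr) (auto simp: in_keys_iff lookup_sum lookup_single when_def
      elim!: sum.not_neutral_contains_not_neutral split: if_splits)

text \<open>Each factor contributes exactly one variable from \<open>S\<close>, so the product is
  homogeneous. The degree count in \<open>lookup_prod_linear_form_Frobenius\<close> rests on
  this.\<close>

lemma keys_prod_linear_form:
  assumes "finite S" "m \<in> Poly_Mapping.keys (\<Prod>b\<leftarrow>w. linear_form c S b)"
  shows "Poly_Mapping.keys m \<subseteq> S \<and> (\<Sum>x\<in>S. Poly_Mapping.lookup m x) = length w"
  using assms(2)
proof (induction w arbitrary: m)
  case Nil
  then show ?case by simp
next
  case (Cons b w)
  then have "m \<in> Poly_Mapping.keys (linear_form c S b * (\<Prod>b\<leftarrow>w. linear_form c S b))" by simp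
  then obtain a m' where a: "a \<in> Poly_Mapping.keys (linear_form c S b)"
    and m': "m' \<in> Poly_Mapping.keys (\<Prod>b\<leftarrow>w. linear_form c S b)" and "m = a + m'"
    using keys_mult by blast
  moreover obtain x where x: "x \<in> S" "a = Poly_Mapping.single x 1"
    using keys_linear_form[OF a] by blast
  ultimately have m: "m = Poly_Mapping.single x 1 + m'" by simp
  have "Poly_Mapping.keys m \<subseteq> insert x (Poly_Mapping.keys m')"
    unfolding m using Poly_Mapping.keys_add[of "Poly_Mapping.single x (1::nat)" m'] by simp
  with Cons.IH[OF m'] x assms(1) show ?case
    by (auto simp: m lookup_add sum.distrib lookup_single when_def)
qed

section \<open>Exponent vectors of lists of powers\<close>

definition exponent :: "('x \<times> nat) list \<Rightarrow> ('x \<Rightarrow>\<^sub>0 nat)"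
  where "exponent ps = (\<Sum>(x, n)\<leftarrow>ps. Poly_Mapping.single x n)"

lemma exponent_Nil [simp]: "exponent [] = 0"
  and exponent_Cons [simp]: "exponent ((x, n) # ps) = Poly_Mapping.single x n + exponent ps"
  by (simp_all add: exponent_def)

text \<open>With \<open>a = q\<close> and \<open>b = q - 1\<close>, this splits the exponents for
  the increased sequence into a multiple of q and a constant residue, as in
  \<open>qnum_Suc\<close>.\<close>

lemma exponent_affine:
  "exponent (map (\<lambda>(x, n). (x, a * n + b)) ps)
    = scale_exponent a (exponent ps) + exponent (map (\<lambda>(x, n). (x, b)) ps)"
proof (induction ps)
  case Nil
  have "scale_exponent a 0 = 0" by (rule poly_mapping_eqI) simp
  then show ?case by simp
next
  case (Cons p ps)
  then show ?case by (cases p) (simp add: scale_exponent_add single_add add_ac)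
qed

lemma lookup_exponent_const:
  assumes "distinct (map fst ps)"
  shows "Poly_Mapping.lookup (exponent (map (\<lambda>(x, n). (x, b)) ps)) x
    = (if x \<in> fst ` set ps then b else 0)"
  using assms
proof (induction ps)
  case (Cons p ps)
  then show ?case by (cases p, cases "fst p = x") (simp_all add: lookup_add lookup_single when_def)
qed simp

text \<open>
  Since \<open>L(t)\<^sup>q = L(t\<^sup>q)\<close> for a linear form \<open>L\<close>, the exponents contributed by the \<open>q\<close>-th powers are
  divisible by \<open>q\<close>; the remaining factor has just the degree that is needed to
  supply the residue \<open>q - 1\<close> for every variable.
\<close>

lemma lookup_prod_linear_form_Frobenius:
  fixes c :: "'x \<Rightarrow> 'b \<Rightarrow> 'k::{field,finite}"
  assumes dist: "distinct (map fst ps)" and S: "S = fst ` set ps"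
    and len: "length w' = length ps * (CARD('k) - 1)"
  shows "Poly_Mapping.lookup
      (\<Prod>b\<leftarrow>concat (replicate CARD('k) w) @ w'. linear_form c S b)
      (exponent (map (\<lambda>(x, n). (x, CARD('k) * n + (CARD('k) - 1))) ps))
    = Poly_Mapping.lookup (\<Prod>b\<leftarrow>w. linear_form c S b) (exponent ps)
      * Poly_Mapping.lookup (\<Prod>b\<leftarrow>w'. linear_form c S b)
          (exponent (map (\<lambda>(x, n). (x, CARD('k) - 1)) ps))"
proof -
  let ?q = "CARD('k)"
  define f where "f = (\<Prod>b\<leftarrow>w. linear_form c S b)"
  define g where "g = (\<Prod>b\<leftarrow>w'. linear_form c S b)"
  define e1 where "e1 = exponent (map (\<lambda>(x, n). (x, ?q - 1)) ps)"
  have fin: "finite S" using S by simp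
  have q: "?q > 0" by simp
  have pow: "(\<Prod>b\<leftarrow>concat (replicate n w). linear_form c S b) = f ^ n" for n
    by (induction n) (simp_all add: f_def)
  have e1: "Poly_Mapping.lookup e1 x = (if x \<in> S then ?q - 1 else 0)" for x
    unfolding e1_def S by (rule lookup_exponent_const[OF dist])
  \<comment> \<open>Only one pair of monomials, from the q-th power and from \<open>g\<close>, can
    multiply to the prescribed one.\<close>
  have uniq: "m = exponent ps"
    if k: "k \<in> Poly_Mapping.keys g"
      and eq: "scale_exponent ?q (exponent ps) + e1 = scale_exponent ?q m + k" for m k
  proof -
    have k_keys: "Poly_Mapping.keys k \<subseteq> S"
      and k_sum: "(\<Sum>x\<in>S. Poly_Mapping.lookup k x) = length w'"
      using keys_prod_linear_form[OF fin k[unfolded g_def]] by blast+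
    have lk: "?q * Poly_Mapping.lookup (exponent ps) x + Poly_Mapping.lookup e1 x
        = ?q * Poly_Mapping.lookup m x + Poly_Mapping.lookup k x" for x
      using arg_cong[OF eq, of "\<lambda>f. Poly_Mapping.lookup f x"] by (simp add: lookup_add)
    have ge: "?q - 1 \<le> Poly_Mapping.lookup k x" if "x \<in> S" for x
    proof -
      \<comment> \<open>Modulo q the q-th power drops out, so every exponent of \<open>k\<close> has
        residue q - 1 and is at least q - 1.\<close>
      have "(?q * Poly_Mapping.lookup (exponent ps) x + (?q - 1)) mod ?q
          = Poly_Mapping.lookup k x mod ?q"
        using lk[of x] e1[of x] that by simp
      then have "Poly_Mapping.lookup k x mod ?q = (?q - 1) mod ?q"
        unfolding mod_mult_self4 by (rule sym)
      also have "\<dots> = ?q - 1" using q by (intro mod_less) simp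
      finally have "Poly_Mapping.lookup k x mod ?q = ?q - 1" .
      then show ?thesis by (metis mod_less_eq_dividend)
    qed
    \<comment> \<open>The degree of \<open>k\<close> equals the sum of these lower bounds, so each
      of them is attained.\<close>
    have "card S = length ps" using dist S by (metis distinct_card length_map set_map)
    then have "(\<Sum>x\<in>S. Poly_Mapping.lookup k x) = (\<Sum>x\<in>S. ?q - 1)"
      using k_sum len by simp
    then have "Poly_Mapping.lookup k x = ?q - 1" if "x \<in> S" for x
      using sum_mono_inv[of "\<lambda>x. ?q - 1" S "Poly_Mapping.lookup k" x] ge that fin by simp
    moreover have "Poly_Mapping.lookup k x = 0" if "x \<notin> S" for x
      using that k_keys by (auto simp: in_keys_iff)
    ultimately have "Poly_Mapping.lookup k x = Poly_Mapping.lookup e1 x" for x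
      using e1 by simp
    with lk have "?q * Poly_Mapping.lookup (exponent ps) x = ?q * Poly_Mapping.lookup m x" for x
      by (metis add_right_cancel)
    then show "m = exponent ps" using q by (intro poly_mapping_eqI) simp
  qed
  let ?t = "\<lambda>m. Poly_Mapping.lookup
    (Poly_Mapping.single (scale_exponent ?q m) (Poly_Mapping.lookup f m) * g)
    (scale_exponent ?q (exponent ps) + e1)"
  have zero: "?t m = 0" if "m \<noteq> exponent ps" for m
    using uniq that by (intro lookup_single_mult_eq_0) blast
  have "Poly_Mapping.lookup (f ^ ?q * g) (scale_exponent ?q (exponent ps) + e1)
      = (\<Sum>m\<in>Poly_Mapping.keys f. ?t m)"
    by (simp add: power_card_eq_scale_exponent sum_distrib_right lookup_sum)
  also have "\<dots> = (\<Sum>m\<in>Poly_Mapping.keys f. if m = exponent ps then ?t (exponent ps) else 0)"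
    using zero by (intro sum.cong) auto
  also have "\<dots> = Poly_Mapping.lookup f (exponent ps) * Poly_Mapping.lookup g e1"
    by (simp add: lookup_single_mult_add in_keys_iff)
  finally show ?thesis
    unfolding exponent_affine map_append prod_list.append pow
    by (simp only: flip: f_def g_def e1_def)
qed

section \<open>Coefficients of shuffle products\<close>

text \<open>For coordinates \<open>c\<close> in a basis, this is the coefficient of the basis tensor
  \<open>w\<close> in the pure tensor \<open>u\<close>; the value 0 for unequal lengths respects the
  grading.\<close>

definition word_coeff :: "('x \<Rightarrow> 'b \<Rightarrow> 'k::field) \<Rightarrow> 'b list \<Rightarrow> 'x list \<Rightarrow> 'k"
  where "word_coeff c w u =
    (if length w = length u then \<Prod>i<length w. c (u ! i) (w ! i) else 0)"

text \<open>A linear functional is a map into the free space on one generator, so that the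
  lemmas on \<open>lin_ext\<close> apply.\<close>

definition coeff_at :: "('x \<Rightarrow> 'b \<Rightarrow> 'k::field) \<Rightarrow> 'b list \<Rightarrow> ('x list \<Rightarrow>\<^sub>0 'k) \<Rightarrow> 'k"
  where "coeff_at c w f =
    Poly_Mapping.lookup (lin_ext (\<lambda>u. Poly_Mapping.single () (word_coeff c w u)) f) ()"

lemma coeff_at_add: "coeff_at c w (f + g) = coeff_at c w f + coeff_at c w g"
  by (simp add: coeff_at_def lin_ext_add lookup_add)

lemma coeff_at_diff: "coeff_at c w (f - g) = coeff_at c w f - coeff_at c w g"
  by (simp add: coeff_at_def lin_ext_diff lookup_minus)

lemma coeff_at_fscale [simp]: "coeff_at c w (fscale a f) = a * coeff_at c w f"
  by (simp add: coeff_at_def lin_ext_fscale)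

lemma coeff_at_sum: "coeff_at c w (\<Sum>i\<in>I. f i) = (\<Sum>i\<in>I. coeff_at c w (f i))"
  by (simp add: coeff_at_def lin_ext_sum lookup_sum)

lemma coeff_at_single [simp]: "coeff_at c w (Poly_Mapping.single u a) = a * word_coeff c w u"
  by (simp add: coeff_at_def)

lemma coeff_at_lin_ext:
  "coeff_at c w (lin_ext h f)
    = (\<Sum>a\<in>Poly_Mapping.keys f. Poly_Mapping.lookup f a * coeff_at c w (h a))"
  by (simp add: lin_ext_def[of h] coeff_at_sum)

section \<open>Subwords at a set of positions\<close>

lemma nths_restrict: "nths xs A = nths xs ({..<length xs} \<inter> A)"
  unfolding nths_def by (intro arg_cong[where f = "map fst"] filter_cong) (auto simp: set_zip)

text \<open>\<open>interleave\<close> addresses letters by their rank; this finds the letter of that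
  rank in the subword.\<close>

lemma nths_nth_rank:
  "i \<in> A \<Longrightarrow> i < length xs \<Longrightarrow> nths xs A ! card (A \<inter> {..<i}) = xs ! i"
proof (induction xs rule: rev_induct)
  case (snoc x xs)
  have "length (nths xs A) = card (A \<inter> {..<length xs})"
    by (simp add: length_nths) (metis Collect_conj_eq Collect_mem_eq Int_commute lessThan_def)
  moreover have "card (A \<inter> {..<i}) < card (A \<inter> {..<length xs})" if "i < length xs"
    using that snoc.prems by (intro psubset_card_mono) auto
  ultimately show ?case
    using snoc by (cases "i = length xs") (auto simp: nths_append nth_append)
qed simp

text \<open>Products over positions, unlike products over lists, can be expanded over
  subsets.\<close>

lemma prod_list_nths:
  "A \<subseteq> {..<length xs} \<Longrightarrow> (\<Prod>x\<leftarrow>nths xs A. f x) = (\<Prod>i\<in>A. f (xs ! i))"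
  for f :: "'a \<Rightarrow> 'b::comm_monoid_mult"
proof (induction xs arbitrary: A rule: rev_induct)
  case (snoc x xs)
  let ?A = "A \<inter> {..<length xs}"
  have "nths xs A = nths xs ?A"
    using nths_restrict[of xs A] by (simp only: Int_commute)
  moreover have "(\<Prod>i\<in>?A. f ((xs @ [x]) ! i)) = (\<Prod>i\<in>?A. f (xs ! i))"
    by (rule prod.cong) (auto simp: nth_append)
  ultimately have IH: "(\<Prod>x\<leftarrow>nths xs A. f x) = (\<Prod>i\<in>?A. f ((xs @ [x]) ! i))"
    using snoc.IH[of ?A] by simp
  show ?case
  proof (cases "length xs \<in> A")
    case True
    then have A: "A = insert (length xs) ?A" using snoc.prems by (auto simp: less_Suc_eq)
    have "(\<Prod>i\<in>A. f ((xs @ [x]) ! i)) = f x * (\<Prod>i\<in>?A. f ((xs @ [x]) ! i))"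
      by (subst A, subst prod.insert) simp_all
    then show ?thesis using IH True by (simp add: nths_append mult.commute)
  next
    case False
    then have "A = ?A" using snoc.prems by (auto simp: less_Suc_eq)
    then show ?thesis using IH False by (simp add: nths_append)
  qed
qed simp

text \<open>The positions in \<open>A\<close> all carry \<open>x\<close>, and the others spell
  \<open>v\<close> in order, so the product splits and the second part is reindexed by rank.\<close>

lemma word_coeff_interleave:
  assumes A: "A \<subseteq> {..<length w}" "card A = n" and len: "length w = n + length v"
  shows "word_coeff c w (interleave A (replicate n x) v)
    = (\<Prod>i\<in>A. c x (w ! i)) * word_coeff c (nths w (- A)) v"
proof -
  let ?N = "{..<length w}"
  let ?B = "?N - A"
  let ?r = "\<lambda>i. card (?B \<inter> {..<i})"
  let ?c = "\<lambda>i. c (interleave A (replicate n x) v ! i) (w ! i)"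
  have finA: "finite A" using A(1) finite_subset by blast
  have cB: "card ?B = length v" using A finA len by (simp add: card_Diff_subset)
  have nths: "nths w (- A) = nths w ?B"
    using nths_restrict[of w "- A"] by (simp only: Diff_eq)
  have "{i. i < length w \<and> i \<in> ?B} = ?B" by auto
  then have len_nths: "length (nths w (- A)) = length v"
    unfolding nths using cB by (simp add: length_nths)
  have "(\<Prod>i\<in>?N. ?c i) = (\<Prod>i\<in>A. ?c i) * (\<Prod>i\<in>?B. ?c i)"
    using A(1) by (simp add: prod.subset_diff mult.commute)
  also have "(\<Prod>i\<in>A. ?c i) = (\<Prod>i\<in>A. c x (w ! i))"
  proof (rule prod.cong[OF refl])
    fix i assume i: "i \<in> A"
    then have "card (A \<inter> {..<i}) < n"
      using bij_betw_rank[OF finA] A(2) unfolding bij_betw_def by blast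
    then show "?c i = c x (w ! i)"
      using i A(1) len by (auto simp: interleave_def)
  qed
  also have "(\<Prod>i\<in>?B. ?c i) = (\<Prod>i\<in>?B. c (v ! ?r i) (nths w (- A) ! ?r i))"
  proof (rule prod.cong[OF refl])
    fix i assume i: "i \<in> ?B"
    then have "{..<i} - A = ?B \<inter> {..<i}" by (intro rank_compl) simp
    then show "?c i = c (v ! ?r i) (nths w (- A) ! ?r i)"
      unfolding nths using i nths_nth_rank[of i ?B w] len by (simp add: interleave_def)
  qed
  also have "\<dots> = (\<Prod>j<length v. c (v ! j) (nths w (- A) ! j))"
    using bij_betw_rank[of ?B] cB by (intro prod.reindex_bij_betw) simp
  finally show ?thesis using len len_nths by (simp add: word_coeff_def)
qed

text \<open>A shuffle chooses which \<open>n\<close> letters of \<open>w\<close> are matched with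
  \<open>x\<close>; the remaining subword is matched with \<open>g\<close>.\<close>

lemma coeff_at_shuffle_replicate:
  "coeff_at c w (shuffle (Poly_Mapping.single (replicate n x) 1) g)
    = (\<Sum>A | A \<subseteq> {..<length w} \<and> card A = n. (\<Prod>i\<in>A. c x (w ! i)) * coeff_at c (nths w (- A)) g)"
proof -
  have word: "coeff_at c w (shuffle_word (replicate n x) v)
    = (\<Sum>A | A \<subseteq> {..<length w} \<and> card A = n. (\<Prod>i\<in>A. c x (w ! i)) * word_coeff c (nths w (- A)) v)"
    for v
  proof (cases "length w = n + length v")
    case True
    then show ?thesis
      by (auto simp: shuffle_word_def coeff_at_sum word_coeff_interleave intro!: sum.cong)
  next
    case False
    have "word_coeff c (nths w (- A)) v = 0" if "A \<subseteq> {..<length w}" "card A = n" for A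
    proof -
      have "{i. i < length w \<and> i \<in> - A} = {..<length w} - A" by auto
      then have "length (nths w (- A)) = length w - n"
        using that finite_subset[OF that(1)] by (simp add: length_nths card_Diff_subset)
      \<comment> \<open>This excludes truncation in \<open>length w - n\<close>, so the remaining
        subword really differs in length from \<open>v\<close>.\<close>
      moreover have "n \<le> length w"
        using card_mono[OF _ that(1)] that(2) by simp
      ultimately show ?thesis using False by (simp add: word_coeff_def)
    qed
    moreover have "coeff_at c w (shuffle_word (replicate n x) v) = 0"
      using False by (auto simp: shuffle_word_def coeff_at_sum word_coeff_def)
    ultimately show ?thesis by simp
  qed
  have "coeff_at c w (shuffle (Poly_Mapping.single (replicate n x) 1) g)
    = (\<Sum>v\<in>Poly_Mapping.keys g. Poly_Mapping.lookup g v *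
        (\<Sum>A | A \<subseteq> {..<length w} \<and> card A = n.
          (\<Prod>i\<in>A. c x (w ! i)) * word_coeff c (nths w (- A)) v))"
    by (simp add: shuffle_def coeff_at_lin_ext word)
  also have "\<dots> = (\<Sum>A | A \<subseteq> {..<length w} \<and> card A = n. (\<Prod>i\<in>A. c x (w ! i)) *
      (\<Sum>v\<in>Poly_Mapping.keys g. Poly_Mapping.lookup g v * word_coeff c (nths w (- A)) v))"
    by (simp add: sum_distrib_left mult_ac) (rule sum.swap)
  also have "\<dots> = (\<Sum>A | A \<subseteq> {..<length w} \<and> card A = n.
      (\<Prod>i\<in>A. c x (w ! i)) * coeff_at c (nths w (- A)) g)"
    by (simp add: coeff_at_def lin_ext_def lookup_sum)
  finally show ?thesis .
qed

text \<open>A representative of \<open>pow_product\<close>, which keeps cosets out of the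
  computation of coefficients.\<close>

definition shuffle_pow :: "('v \<times> nat) list \<Rightarrow> ('v list \<Rightarrow>\<^sub>0 'k::field)"
  where "shuffle_pow ps =
    foldr (\<lambda>(x, n) g. shuffle (Poly_Mapping.single (replicate n x) 1) g) ps
      (Poly_Mapping.single [] 1)"

text \<open>Expanding the product over the set of positions where the first variable is picked gives
  the recursion of \<open>coeff_at_shuffle_replicate\<close>.\<close>

lemma coeff_at_shuffle_pow:
  assumes "distinct (map fst ps)"
  shows "coeff_at c w (shuffle_pow ps)
    = Poly_Mapping.lookup (\<Prod>b\<leftarrow>w. linear_form c (fst ` set ps) b) (exponent ps)"
  using assms
proof (induction ps arbitrary: w)
  case Nil
  then show ?case
    by (cases w) (simp_all add: shuffle_pow_def linear_form_def word_coeff_def)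
next
  case (Cons p ps)
  obtain x n where p: "p = (x, n)" by (cases p)
  let ?S = "fst ` set ps" and ?N = "{..<length w}" and ?X = "Poly_Mapping.single x (1::nat)"
  let ?P = "\<lambda>A. \<Prod>i\<in>A. c x (w ! i)" and ?L = "\<lambda>A. \<Prod>i\<in>?N - A. linear_form c ?S (w ! i)"
  have x: "x \<notin> ?S" and dist: "distinct (map fst ps)" using Cons.prems p by auto
  have nths: "(\<Prod>b\<leftarrow>nths w (- A). linear_form c ?S b) = ?L A" for A
  proof -
    have "nths w (- A) = nths w (?N - A)"
      using nths_restrict[of w "- A"] by (simp only: Diff_eq)
    then show ?thesis by (simp add: prod_list_nths)
  qed
  have monom: "(\<Prod>i\<in>A. Poly_Mapping.single ?X (c x (w ! i)))
      = Poly_Mapping.single (Poly_Mapping.single x (card A)) (?P A)" if "A \<subseteq> ?N" for A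
    using finite_subset[OF that finite_lessThan]
    by (induction A) (simp_all add: mult_single flip: single_add)
  \<comment> \<open>By distinctness the forms outside \<open>A\<close> are free of \<open>x\<close>,
    so the exponent of \<open>x\<close> is exactly \<open>card A\<close>.\<close>
  have summand: "Poly_Mapping.lookup
        (Poly_Mapping.single (Poly_Mapping.single x (card A)) (?P A) * ?L A) (exponent (p # ps))
      = (if card A = n then ?P A * coeff_at c (nths w (- A)) (shuffle_pow ps) else 0)"
    (is "?lhs A = _") if "A \<subseteq> ?N" for A
  proof (cases "card A = n")
    case True
    then show ?thesis
      by (simp add: p lookup_single_mult_add Cons.IH[OF dist] nths)
  next
    case False
    have not_x: "Poly_Mapping.lookup k x = 0" if "k \<in> Poly_Mapping.keys (?L A)" for k
      using keys_prod_linear_form[of ?S k c "nths w (- A)"] that x by (auto simp: nths in_keys_iff)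
    have "k \<in> Poly_Mapping.keys (?L A) \<Longrightarrow>
        exponent (p # ps) \<noteq> Poly_Mapping.single x (card A) + k" for k
    proof
      assume k: "k \<in> Poly_Mapping.keys (?L A)"
        and eq: "exponent (p # ps) = Poly_Mapping.single x (card A) + k"
      have "Poly_Mapping.lookup (exponent ps) x = 0"
        using x by (induction ps) (auto simp: lookup_add lookup_single when_def)
      then show False
        using arg_cong[OF eq, of "\<lambda>f. Poly_Mapping.lookup f x"] not_x[OF k] False
        by (simp add: p lookup_add)
    qed
    then have "?lhs A = 0" by (rule lookup_single_mult_eq_0)
    then show ?thesis using False by simp
  qed
  have lin: "linear_form c (fst ` set (p # ps)) b
      = Poly_Mapping.single ?X (c x b) + linear_form c ?S b" for b
    using x by (simp add: linear_form_def p)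
  have "(\<Prod>b\<leftarrow>w. linear_form c (fst ` set (p # ps)) b)
      = (\<Prod>i\<in>?N. Poly_Mapping.single ?X (c x (w ! i)) + linear_form c ?S (w ! i))"
    unfolding lin using prod_list_nths[of ?N w] by simp
  also have "\<dots> = (\<Sum>A\<in>Pow ?N. (\<Prod>i\<in>A. Poly_Mapping.single ?X (c x (w ! i))) * ?L A)"
    by (rule prod_add) simp
  also have "\<dots> = (\<Sum>A\<in>Pow ?N. Poly_Mapping.single (Poly_Mapping.single x (card A)) (?P A) * ?L A)"
    by (intro sum.cong refl) (simp only: Pow_iff monom)
  finally have "Poly_Mapping.lookup (\<Prod>b\<leftarrow>w. linear_form c (fst ` set (p # ps)) b) (exponent (p # ps))
      = (\<Sum>A\<in>Pow ?N. ?lhs A)"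
    by (simp only: lookup_sum)
  also have "\<dots> = (\<Sum>A\<in>Pow ?N.
      if card A = n then ?P A * coeff_at c (nths w (- A)) (shuffle_pow ps) else 0)"
    by (intro sum.cong refl) (simp only: Pow_iff summand)
  also have "\<dots> = coeff_at c w (shuffle_pow (p # ps))"
    by (simp add: shuffle_pow_def p coeff_at_shuffle_replicate sum.If_cases Int_def conj_commute)
  finally show ?case ..
qed

section \<open>Coefficients detect the tensor relations\<close>

text \<open>Isolating the factor at \<open>i\<close> makes linearity in that letter visible.\<close>

lemma word_coeff_update:
  assumes "i < length u"
  shows "word_coeff c w (u[i := x]) =
    (if length w = length u then c x (w ! i) * (\<Prod>j\<in>{..<length w} - {i}. c (u ! j) (w ! j)) else 0)"
proof (cases "length w = length u")
  case True
  then have "(\<Prod>j<length w. c (u[i := x] ! j) (w ! j))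
      = c (u[i := x] ! i) (w ! i) * (\<Prod>j\<in>{..<length w} - {i}. c (u[i := x] ! j) (w ! j))"
    using assms by (intro prod.remove) auto
  also have "(\<Prod>j\<in>{..<length w} - {i}. c (u[i := x] ! j) (w ! j))
      = (\<Prod>j\<in>{..<length w} - {i}. c (u ! j) (w ! j))"
    by (rule prod.cong) auto
  finally show ?thesis using True assms by (simp add: word_coeff_def)
qed (simp add: word_coeff_def)

text \<open>\<open>word_coeff\<close> is linear in each letter of the word and so kills the
  generating relations; hence \<open>coeff_at\<close> is well defined on cosets.\<close>

lemma coeff_at_tensor_rel:
  assumes add: "\<And>x y b. c (x + y) b = c x b + c y b" and scale: "\<And>a x b. c (scale a x) b = a * c x b"
    and f: "f \<in> tensor_rel scale"
  shows "coeff_at c w f = 0"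
  using f[unfolded tensor_rel_def]
proof (induction rule: free.span_induct_alt)
  case base
  show ?case by (simp add: coeff_at_def)
next
  case (step a f g)
  have "coeff_at c w f = 0"
    using step(1) by (auto simp: coeff_at_diff word_coeff_update add scale distrib_right mult.assoc
        simp del: fscale_single)
  then show ?case using step(2) by (simp add: coeff_at_add)
qed

section \<open>Expansion of tensors in a basis\<close>

lemma tensor_rel_single_scale_append:
  "Poly_Mapping.single (p @ scale a x # u) 1 - fscale a (Poly_Mapping.single (p @ x # u) 1)
    \<in> tensor_rel scale"
  using tensor_rel_single_scale[of "length p" "p @ x # u" scale a x] by simp

lemma tensor_rel_single_add_append:
  "Poly_Mapping.single (p @ (x + y) # u) 1 - Poly_Mapping.single (p @ x # u) 1
    - Poly_Mapping.single (p @ y # u) 1 \<in> tensor_rel scale"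
  using tensor_rel_single_add[of "length p" "p @ x # u" x y scale] by simp

context finite_dimensional_vector_space
begin

lemma tensor_rel_single_sum:
  assumes "finite I"
  shows "Poly_Mapping.single (p @ (\<Sum>i\<in>I. scale (a i) (x i)) # u) 1
    - (\<Sum>i\<in>I. fscale (a i) (Poly_Mapping.single (p @ x i # u) 1)) \<in> tensor_rel scale"
  using assms
proof (induction I)
  case empty
  \<comment> \<open>The empty sum is the scalar multiple of 0 by 0, so a homogeneity relation kills
    the word.\<close>
  show ?case using tensor_rel_single_scale_append[of p scale 0 0 u] by simp
next
  case (insert i I)
  let ?s = "\<lambda>y. Poly_Mapping.single (p @ y # u) (1 :: 'a)"
  let ?y = "\<Sum>i\<in>I. scale (a i) (x i)" and ?f = "\<Sum>i\<in>I. fscale (a i) (?s (x i))"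
  have "?s (scale (a i) (x i) + ?y) - (fscale (a i) (?s (x i)) + ?f)
      = (?s (scale (a i) (x i) + ?y) - ?s (scale (a i) (x i)) - ?s ?y)
        + (?s (scale (a i) (x i)) - fscale (a i) (?s (x i))) + (?s ?y - ?f)"
    by (simp del: fscale_single)
  also have "\<dots> \<in> tensor_rel scale"
    by (intro tensor_rel_add tensor_rel_single_add_append tensor_rel_single_scale_append insert.IH)
  finally show ?case using insert.hyps by (simp del: fscale_single)
qed

definition basis_words :: "nat \<Rightarrow> 'b list set"
  where "basis_words n = {w. set w \<subseteq> Basis \<and> length w = n}"

lemma finite_basis_words: "finite (basis_words n)"
  unfolding basis_words_def by (rule finite_lists_length_eq[OF finite_Basis])

lemma basis_words_Suc:
  "(\<Sum>w\<in>basis_words (Suc n). F w) = (\<Sum>b\<in>Basis. \<Sum>w\<in>basis_words n. F (b # w))"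
  for F :: "'b list \<Rightarrow> 'c::comm_monoid_add"
proof -
  have "(\<Sum>b\<in>Basis. \<Sum>w\<in>basis_words n. F (b # w))
      = (\<Sum>(b, w)\<in>Basis \<times> basis_words n. F (b # w))"
    by (simp add: sum.cartesian_product)
  also have "\<dots> = (\<Sum>w\<in>basis_words (Suc n). F w)"
    by (rule sum.reindex_bij_witness[of _ "\<lambda>w. (hd w, tl w)" "\<lambda>(b, w). b # w"])
       (auto simp: basis_words_def length_Suc_conv)
  finally show ?thesis ..
qed

text \<open>Letters are expanded from the left; the prefix \<open>p\<close> collects those already
  expanded, and the induction hypothesis is applied to \<open>p @ [b]\<close>.\<close>

lemma single_equiv_basis_words:
  "Poly_Mapping.single (p @ u) 1 - (\<Sum>w\<in>basis_words (length u).
      fscale (word_coeff (representation Basis) w u) (Poly_Mapping.single (p @ w) 1))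
    \<in> tensor_rel scale"
proof (induction u arbitrary: p)
  case Nil
  have "basis_words 0 = {[]}" by (auto simp: basis_words_def)
  then show ?case by (simp add: word_coeff_def)
next
  case (Cons x u)
  let ?c = "representation Basis"
  let ?s = "\<lambda>b. Poly_Mapping.single (p @ b # u) (1 :: 'a)"
  let ?t = "\<lambda>b. \<Sum>w\<in>basis_words (length u).
      fscale (word_coeff ?c w u) (Poly_Mapping.single (p @ b # w) (1 :: 'a))"
  have x: "(\<Sum>b\<in>Basis. scale (?c x b) b) = x"
    using independent_Basis span_Basis finite_Basis by (intro sum_representation_eq) auto
  have "?s x - (\<Sum>b\<in>Basis. fscale (?c x b) (?s b)) \<in> tensor_rel scale"
    using tensor_rel_single_sum[OF finite_Basis, of p "?c x" "\<lambda>b. b" u] unfolding x .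
  moreover have "fscale (?c x b) (?s b - ?t b) \<in> tensor_rel scale" for b
    using Cons.IH[of "p @ [b]"] by (intro tensor_rel_fscale) simp
  then have "(\<Sum>b\<in>Basis. fscale (?c x b) (?s b - ?t b)) \<in> tensor_rel scale"
    by (rule tensor_rel_sum)
  ultimately have "?s x - (\<Sum>b\<in>Basis. fscale (?c x b) (?s b))
      + (\<Sum>b\<in>Basis. fscale (?c x b) (?s b - ?t b)) \<in> tensor_rel scale"
    by (rule tensor_rel_add)
  also have "?s x - (\<Sum>b\<in>Basis. fscale (?c x b) (?s b))
      + (\<Sum>b\<in>Basis. fscale (?c x b) (?s b - ?t b)) = ?s x - (\<Sum>b\<in>Basis. fscale (?c x b) (?t b))"
    by (simp add: free.scale_right_diff_distrib sum_subtractf del: fscale_single)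
  also have "(\<Sum>b\<in>Basis. fscale (?c x b) (?t b))
      = (\<Sum>w\<in>basis_words (Suc (length u)).
          fscale (word_coeff ?c w (x # u)) (Poly_Mapping.single (p @ w) 1))"
    unfolding basis_words_Suc
    by (intro sum.cong refl)
       (auto simp: free.scale_sum_right word_coeff_def prod.lessThan_Suc_shift basis_words_def
         simp del: fscale_single prod.lessThan_Suc)
  finally show ?case by simp
qed

text \<open>Modulo the relations, \<open>f\<close> is the combination of basis words with
  coefficients \<open>coeff_at\<close>, all of which vanish.\<close>

lemma tensor_relI:
  assumes "\<And>w. set w \<subseteq> Basis \<Longrightarrow> coeff_at (representation Basis) w f = 0"
  shows "f \<in> tensor_rel scale"
proof -
  let ?c = "representation Basis"
  let ?K = "Poly_Mapping.keys f"
  \<comment> \<open>One finite set of words serves every \<open>u\<close>, so that the sums can be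
    exchanged; words of a length other than that of \<open>u\<close> have coefficient 0.\<close>
  define W where "W = (\<Union>u\<in>?K. basis_words (length u))"
  have W: "finite W" unfolding W_def using finite_basis_words by simp
  have "Poly_Mapping.single u 1
      - (\<Sum>w\<in>W. fscale (word_coeff ?c w u) (Poly_Mapping.single w 1)) \<in> tensor_rel scale"
    if "u \<in> ?K" for u
  proof -
    have "(\<Sum>w\<in>basis_words (length u). fscale (word_coeff ?c w u) (Poly_Mapping.single w (1::'a)))
        = (\<Sum>w\<in>W. fscale (word_coeff ?c w u) (Poly_Mapping.single w 1))"
      using that W by (intro sum.mono_neutral_left) (auto simp: W_def basis_words_def word_coeff_def)
    then show ?thesis using single_equiv_basis_words[of "[]" u] by simp
  qed
  then have "lin_ext (\<lambda>u. Poly_Mapping.single u 1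
      - (\<Sum>w\<in>W. fscale (word_coeff ?c w u) (Poly_Mapping.single w 1))) f \<in> tensor_rel scale"
    by (rule tensor_rel_lin_ext)
  moreover have "lin_ext (\<lambda>u. fscale (word_coeff ?c w u) (Poly_Mapping.single w 1)) f = 0"
    if "w \<in> W" for w
  proof -
    have "coeff_at ?c w f = 0" using that by (intro assms) (auto simp: W_def basis_words_def)
    then have "(\<Sum>u\<in>?K. Poly_Mapping.lookup f u * word_coeff ?c w u) = 0"
      by (simp add: coeff_at_def lin_ext_def lookup_sum)
    then have "Poly_Mapping.lookup
        (lin_ext (\<lambda>u. fscale (word_coeff ?c w u) (Poly_Mapping.single w 1)) f) k = 0" for k
      by (cases "w = k") (simp_all add: lin_ext_def lookup_sum lookup_single)
    then show ?thesis by (intro poly_mapping_eqI) simp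
  qed
  moreover have "lin_ext (\<lambda>u. Poly_Mapping.single u 1) f = f"
    using sum_single_lookup[of f] by (simp add: lin_ext_def)
  ultimately show ?thesis by (simp add: lin_ext_hom_diff lin_ext_hom_sum del: fscale_single)
qed

lemma coeff_at_representation_tensor_rel:
  "f \<in> tensor_rel scale \<Longrightarrow> coeff_at (representation Basis) w f = 0"
  using independent_Basis span_Basis
  by (intro coeff_at_tensor_rel) (simp_all add: representation_add representation_scale)

end

section \<open>Injectivity\<close>

lemma pow_product_eq_shuffle_pow:
  fixes scale :: "'k::{field,finite} \<Rightarrow> 'v::ab_group_add \<Rightarrow> 'v"
  shows "pow_product scale s vs = tensor_class scale (shuffle_pow (zip vs (map (qnum CARD('k)) s)))"
proof (induction vs arbitrary: s)
  case Nil
  show ?case by (simp add: pow_product_def shuffle_pow_def one_shuffle_algebra)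
next
  case (Cons x vs)
  show ?case
  proof (cases s)
    case Nil
    then show ?thesis by (simp add: pow_product_def shuffle_pow_def one_shuffle_algebra)
  next
    case (Cons n s')
    then show ?thesis using Cons.IH[of s']
      by (simp add: pow_product_def shuffle_pow_def tensor_pow_def mult_shuffle_algebra)
  qed
qed

definition flag_basis ::
    "('k::field \<Rightarrow> 'v::ab_group_add \<Rightarrow> 'v) \<Rightarrow> 'v set list \<Rightarrow> 'v list"
  where "flag_basis scale W = (SOME vs. adapted_basis scale W vs)"

text \<open>A representative of \<open>phi_flag scale s W\<close>, built from the same choice of
  adapted basis.\<close>

definition flag_tensor ::
    "('k::{field,finite} \<Rightarrow> 'v::ab_group_add \<Rightarrow> 'v) \<Rightarrow> nat list \<Rightarrow> 'v set list \<Rightarrow> ('v list \<Rightarrow>\<^sub>0 'k)"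
  where "flag_tensor scale s W = shuffle_pow (zip (flag_basis scale W) (map (qnum CARD('k)) s))"

lemma adapted_flag_basis:
  "vector_space scale \<Longrightarrow> W \<in> complete_flags scale r \<Longrightarrow> adapted_basis scale W (flag_basis scale W)"
  unfolding flag_basis_def by (rule someI_ex) (rule adapted_basis_exists)

lemma phi_eq_lin_ext: "phi scale s f = tensor_class scale (lin_ext (flag_tensor scale s) f)"
  by (simp add: phi_def phi_flag_def pow_product_eq_shuffle_pow smult_shuffle_algebra
      finsum_shuffle_algebra lin_ext_def flag_tensor_def flag_basis_def)

text \<open>Triviality of the kernel, expressed on representatives; flag spaces are closed under
  differences.\<close>

lemma inj_on_phi_iff:
  "inj_on (phi scale s) (flag_space scale r) \<longleftrightarrow>
    (\<forall>f\<in>flag_space scale r. lin_ext (flag_tensor scale s) f \<in> tensor_rel scale \<longrightarrow> f = 0)"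
proof -
  have "f - g \<in> flag_space scale r" if "f \<in> flag_space scale r" "g \<in> flag_space scale r" for f g
    using that by (auto simp: flag_space_def in_keys_iff lookup_minus)
      (metis in_keys_iff subsetD diff_0_right)
  moreover have "0 \<in> flag_space scale r" by (simp add: flag_space_def)
  ultimately show ?thesis
    unfolding inj_on_def phi_eq_lin_ext tensor_class_eq_iff lin_ext_diff[symmetric]
    by (metis diff_zero right_minus_eq)
qed

lemma qnum_Suc: "q > 0 \<Longrightarrow> qnum q (Suc n) = q * qnum q n + (q - 1)"
  by (simp add: qnum_def algebra_simps)

text \<open>The adapted basis depends only on the flag, so both sequences use the same variables and
  the Frobenius factorization applies.\<close>

lemma coeff_at_flag_tensor_map_Suc:
  fixes scale :: "'k::{field,finite} \<Rightarrow> 'v::ab_group_add \<Rightarrow> 'v"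
  assumes "vector_space scale" and W: "W \<in> complete_flags scale (length s)"
    and w': "length w' = length s * (CARD('k) - 1)"
  shows "coeff_at c (concat (replicate CARD('k) w) @ w') (flag_tensor scale (map Suc s) W)
    = coeff_at c w (flag_tensor scale s W)
      * coeff_at c w' (shuffle_pow (map (\<lambda>x. (x, CARD('k) - 1)) (flag_basis scale W)))"
proof -
  let ?q = "CARD('k)" and ?vs = "flag_basis scale W"
  define ps where "ps = zip ?vs (map (qnum ?q) s)"
  have "adapted_basis scale W ?vs" by (rule adapted_flag_basis[OF assms(1) W])
  then have len: "length ?vs = length s" and dist: "distinct ?vs"
    using W by (auto simp: adapted_basis_def complete_flags_def)
  have fst: "map fst ps = ?vs" and len_ps: "length ps = length s"
    using len by (simp_all add: ps_def)
  have Suc: "zip ?vs (map (qnum ?q) (map Suc s)) = map (\<lambda>(x, n). (x, ?q * n + (?q - 1))) ps"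
    using len by (intro nth_equalityI) (simp_all add: ps_def qnum_Suc del: add_diff_assoc)
  have const: "map (\<lambda>x. (x, ?q - 1)) ?vs = map (\<lambda>(x, n). (x, ?q - 1)) ps"
    unfolding fst[symmetric] by (simp add: case_prod_unfold)
  have affine: "fst ` set (map (\<lambda>(x, n). (x, h n)) ps) = fst ` set ps"
    "map fst (map (\<lambda>(x, n). (x, h n)) ps) = map fst ps" for h :: "nat \<Rightarrow> nat"
    by (force simp: image_image case_prod_unfold)+
  note dist_ps = dist[folded fst]
  show ?thesis
    unfolding flag_tensor_def Suc const ps_def[symmetric]
    by (simp only: coeff_at_shuffle_pow affine dist_ps
        lookup_prod_linear_form_Frobenius[OF dist_ps refl w'[folded len_ps]])
qed

theorem proposition2:
  fixes scale :: "'k::{field,finite} \<Rightarrow> 'v::ab_group_add \<Rightarrow> 'v"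
    and Basis :: "'v set" and r :: nat and s :: "nat list"
  assumes "finite_dimensional_vector_space scale Basis"
    and "r > 0" and "length s = r" and "sorted_wrt (>) (s @ [0])"
    and "inj_on (phi scale s) (flag_space scale r)"
  shows "inj_on (phi scale (map Suc s)) (flag_space scale r)"
  unfolding inj_on_phi_iff
proof (intro ballI impI, rule ccontr)
  fix f assume f: "f \<in> flag_space scale r" "f \<noteq> 0"
    and rel: "lin_ext (flag_tensor scale (map Suc s)) f \<in> tensor_rel scale"
  interpret V: finite_dimensional_vector_space scale Basis by fact
  let ?q = "CARD('k)"
  have vs: "vector_space scale" by unfold_locales
  obtain W\<^sub>0 where W\<^sub>0: "W\<^sub>0 \<in> Poly_Mapping.keys f"
    using f(2) poly_mapping_eqI[of f 0] by (auto simp: in_keys_iff)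
  have flags: "W \<in> complete_flags scale (length s)" if "W \<in> Poly_Mapping.keys f" for W
    using f(1) that assms(3) by (auto simp: flag_space_def)
  define v where "v = flag_basis scale W\<^sub>0"
  have "adapted_basis scale W\<^sub>0 v"
    unfolding v_def by (rule adapted_flag_basis[OF vs flags[OF W\<^sub>0]])
  then have v: "length v = length s" "distinct v" "V.independent (set v)"
    using flags[OF W\<^sub>0] by (auto simp: adapted_basis_def complete_flags_def)
  define B where "B = V.extend_basis (set v)"
  have B: "set v \<subseteq> B" "V.independent B" "V.span B = UNIV"
    unfolding B_def using V.extend_basis_superset V.independent_extend_basis V.span_extend_basis v(3)
    by auto
  \<comment> \<open>The tensor relations do not depend on a basis, so coefficients may be taken in
    one adapted to the chosen flag.\<close>
  interpret B: finite_dimensional_vector_space scale B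
    using B V.finiteI_independent by unfold_locales auto
  let ?c = "V.representation B"
  define w\<^sub>0 where "w\<^sub>0 = concat (map (\<lambda>x. replicate (?q - 1) x) v)"
  have len_w\<^sub>0: "length w\<^sub>0 = length s * (?q - 1)"
    unfolding w\<^sub>0_def v(1)[symmetric] by (induction v) simp_all
  define a where
    "a W = coeff_at ?c w\<^sub>0 (shuffle_pow (map (\<lambda>x. (x, ?q - 1)) (flag_basis scale W)))" for W
  have a\<^sub>0: "a W\<^sub>0 = 1"
  proof -
    \<comment> \<open>As \<open>v\<close> lies in the basis \<open>B\<close>, the form at a letter
      of \<open>v\<close> is the variable itself; along \<open>w\<^sub>0\<close> the product is a
      single monomial with coefficient 1.\<close>
    have "linear_form ?c (set v) x = Poly_Mapping.single (Poly_Mapping.single x 1) 1"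
      if "x \<in> set v" for x
    proof -
      have "linear_form ?c (set v) x
          = (\<Sum>y\<in>set v. if y = x then Poly_Mapping.single (Poly_Mapping.single y 1) 1 else 0)"
        unfolding linear_form_def using B that
        by (intro sum.cong refl) (auto simp: V.representation_basis subset_iff)
      then show ?thesis using that by simp
    qed
    then have "(\<Prod>x\<leftarrow>concat (map (\<lambda>x. replicate (?q - 1) x) u). linear_form ?c (set v) x)
        = Poly_Mapping.single (exponent (map (\<lambda>x. (x, ?q - 1)) u)) 1" if "set u \<subseteq> set v" for u
      using that
      by (induction u) (simp_all add: power_single mult_single)
    from this[of v] have "(\<Prod>x\<leftarrow>w\<^sub>0. linear_form ?c (set v) x)
        = Poly_Mapping.single (exponent (map (\<lambda>x. (x, ?q - 1)) v)) 1"
      unfolding w\<^sub>0_def by simp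
    then show ?thesis
      unfolding a_def v_def[symmetric] using v(2)
      by (subst coeff_at_shuffle_pow) (simp_all add: comp_def image_image)
  qed
  \<comment> \<open>The weights \<open>a W\<close> are independent of the word \<open>w\<close>
    below, so they can be absorbed into the relation.\<close>
  define g where "g = lin_ext (\<lambda>W. Poly_Mapping.single W (a W)) f"
  have g: "Poly_Mapping.lookup g W = Poly_Mapping.lookup f W * a W" for W
    by (simp add: g_def lin_ext_def lookup_sum lookup_single when_def in_keys_iff)
  have "lin_ext (flag_tensor scale s) g \<in> tensor_rel scale"
  proof (rule B.tensor_relI)
    fix w
    have "coeff_at ?c w (lin_ext (flag_tensor scale s) g)
        = coeff_at ?c (concat (replicate ?q w) @ w\<^sub>0) (lin_ext (flag_tensor scale (map Suc s)) f)"
      unfolding g_def lin_ext_lin_ext lin_ext_single coeff_at_lin_ext coeff_at_fscale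
      by (intro sum.cong refl)
         (simp add: coeff_at_flag_tensor_map_Suc[OF vs flags len_w\<^sub>0] a_def mult_ac)
    also have "\<dots> = 0" by (rule B.coeff_at_representation_tensor_rel[OF rel])
    finally show "coeff_at ?c w (lin_ext (flag_tensor scale s) g) = 0" .
  qed
  moreover have "g \<in> flag_space scale r"
    using f(1) by (auto simp: flag_space_def in_keys_iff g)
  ultimately have "g = 0"
    using assms(5) unfolding inj_on_phi_iff by blast
  then have "Poly_Mapping.lookup f W\<^sub>0 = 0"
    using g[of W\<^sub>0] a\<^sub>0 by simp
  with W\<^sub>0 show False by (simp add: in_keys_iff)
qed

end
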